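(* Let $\mathcal N$ be a quantum channel from $\mathcal L(A')$ to $\mathcal L(B)$ and let $0\le\epsilon<1$. Then $$C^{(1)}_{\mathrm E}(\mathcal N,\epsilon)\le C^{(1)}_{\mathrm{NS}}(\mathcal N,\epsilon)\qquad\text{and}\qquad C^{(1)}(\mathcal N,\epsilon)\le C^{(1)}_{\mathrm{NS}\cap\mathrm{PPT}}(\mathcal N,\epsilon),$$ where $C^{(1)}_{\mathrm E}$ and $C^{(1)}$ are the one-shot $\epsilon$-error entanglement-assisted and unassisted classical capacities, and $C^{(1)}_{\mathrm{NS}}$ and $C^{(1)}_{\mathrm{NS}\cap\mathrm{PPT}}$ are the one-shot $\epsilon$-error capacities assisted by no-signalling codes and by no-signalling and PPT-preserving codes.
   Context: All Hilbert spaces are finite-dimensional, $A\cong A'$, $\log$ is base 2. A quantum channel is a completely positive trace-preserving linear map; its Choi matrix is $J_{\mathcal N}=\sum_{i,j}|i\rangle\langle j|_A\otimes\mathcal N(|i\rangle\langle j|_{A'})$. $T_B$ is the partial transpose on $B$. Unassisted and entanglement-assisted codes. For an integer $m\ge1$, with classical message registers $A_i=B_o=\mathbb C^m$: an unassisted code consists of channels $\mathcal E$ from $A_i$ to $A'$ and $\mathcal D$ from $B$ to $B_o$, giving $\mathcal M=\mathcal D\circ\mathcal N\circ\mathcal E$; an entanglement-assisted code consists of a shared state $\varphi_{\hat A\hat B}$ on arbitrary systems $\hat A,\hat B$ and channels $\mathcal E$ from $A_i\hat A$ to $A'$ and $\mathcal D$ from $B\hat B$ to $B_o$, giving $\mathcal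 M(\cdot)=\mathcal D\circ(\mathcal N\otimes\mathrm{id}_{\hat B})\circ(\mathcal E\otimes\mathrm{id}_{\hat B})(\,\cdot\otimes\varphi_{\hat A\hat B})$. The average success probability is $\frac1m\sum_{k=1}^m\operatorname{Tr}(\mathcal M(|k\rangle\langle k|)|k\rangle\langle k|)$; let $f_{\mathrm{UA}}(\mathcal N,m)$ and $f_{\mathrm{EA}}(\mathcal N,m)$ be its suprema over the respective codes. Then $C^{(1)}(\mathcal N,\epsilon)=\sup\{\log m:1-f_{\mathrm{UA}}(\mathcal N,m)\le\epsilon\}$ and $C^{(1)}_{\mathrm E}(\mathcal N,\epsilon)=\sup\{\log m:1-f_{\mathrm{EA}}(\mathcal N,m)\le\epsilon\}$. The NS$\cap$PPT- and NS-assisted one-shot capacities are given by the semidefinite programs $$C^{(1)}_{\mathrm{NS}\cap\mathrm{PPT}}(\mathcal N,\epsilon)=-\log\min\{\eta:\ 0\le F_{AB}\le\rho_A\otimes\mathbb 1_B,\ \operatorname{Tr}\rho_A=1,\ \operatorname{Tr}_AF_{AB}=\eta\mathbb 1_B,\ \operatorname{Tr}J_{\mathcal N}F_{AB}\ge1-\epsilon,\ 0\le F_{AB}^{T_B}\le\rho_A\otimes\mathbb 1_B\},$$ and $C^{(1)}_{\mathrm{NS}}(\mathcal N,\epsilon)$ by the same program without the last constraint. *)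

theory Defs
  imports
    "Jordan_Normal_Form.Schur_Decomposition"
    "HOL-Library.Extended_Real"
begin

text \<open>
  A system of dimension \<open>d\<close> is \<open>\<complex>\<^sup>d\<close> with its standard basis indexed by \<open>0, \<dots>, d - 1\<close>, and an
  operator on it is an element of \<open>carrier_mat d d\<close>.  The basis vector
  \<open>|i\<rangle> \<otimes> |k\<rangle>\<close> of the tensor product of systems of dimensions \<open>d\<close> and \<open>e\<close> has index
  \<open>i * e + k\<close>; with this convention the tensor product is strictly associative.
\<close>

definition mtrace :: "complex mat \<Rightarrow> complex" where
  "mtrace A = (\<Sum>i<dim_row A. A $$ (i, i))"

definition psd :: "nat \<Rightarrow> complex mat \<Rightarrow> bool" where
  "psd d A \<longleftrightarrow> A \<in> carrier_mat d d \<and> mat_adjoint A = A \<and>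
     (\<forall>v \<in> carrier_vec d. 0 \<le> Re ((A *\<^sub>v v) \<bullet>c v))"

text \<open>The order \<open>\<le>\<close> on matrices inherited from the library is not the Loewner order.\<close>

definition loewner_le :: "nat \<Rightarrow> complex mat \<Rightarrow> complex mat \<Rightarrow> bool" where
  "loewner_le d A B \<longleftrightarrow> A \<in> carrier_mat d d \<and> B \<in> carrier_mat d d \<and> psd d (B - A)"

definition density :: "nat \<Rightarrow> complex mat \<Rightarrow> bool" where
  "density d \<rho> \<longleftrightarrow> psd d \<rho> \<and> mtrace \<rho> = 1"

definition ketbra :: "nat \<Rightarrow> nat \<Rightarrow> nat \<Rightarrow> complex mat" where
  "ketbra d i j = mat d d (\<lambda>(r, c). if r = i \<and> c = j then 1 else 0)"

definition kron :: "complex mat \<Rightarrow> complex mat \<Rightarrow> complex mat" where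
  "kron X Y = mat (dim_row X * dim_row Y) (dim_col X * dim_col Y)
     (\<lambda>(r, c). X $$ (r div dim_row Y, c div dim_col Y) * Y $$ (r mod dim_row Y, c mod dim_col Y))"

definition ptrace_left :: "nat \<Rightarrow> nat \<Rightarrow> complex mat \<Rightarrow> complex mat" where
  "ptrace_left dA dB F = mat dB dB (\<lambda>(b, b'). \<Sum>a<dA. F $$ (a * dB + b, a * dB + b'))"

definition ptranspose_right :: "nat \<Rightarrow> nat \<Rightarrow> complex mat \<Rightarrow> complex mat" where
  "ptranspose_right dA dB F = mat (dA * dB) (dA * dB)
     (\<lambda>(r, c). F $$ (r div dB * dB + c mod dB, c div dB * dB + r mod dB))"

definition linear_superop :: "nat \<Rightarrow> nat \<Rightarrow> (complex mat \<Rightarrow> complex mat) \<Rightarrow> bool" where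
  "linear_superop dI dO N \<longleftrightarrow>
     (\<forall>X \<in> carrier_mat dI dI. N X \<in> carrier_mat dO dO) \<and>
     (\<forall>X \<in> carrier_mat dI dI. \<forall>Y \<in> carrier_mat dI dI. N (X + Y) = N X + N Y) \<and>
     (\<forall>c. \<forall>X \<in> carrier_mat dI dI. N (c \<cdot>\<^sub>m X) = c \<cdot>\<^sub>m N X)"

text \<open>
  The map \<open>N \<otimes> id\<close> on a system of dimension \<open>dI * k\<close>: \<open>N\<close> is applied to each of the
  \<open>k\<^sup>2\<close> blocks \<open>\<langle>p| X |q\<rangle>\<close>, where \<open>|p\<rangle>, |q\<rangle>\<close> are basis vectors of the second factor.
\<close>

definition superop_tensor_id ::
    "nat \<Rightarrow> nat \<Rightarrow> nat \<Rightarrow> (complex mat \<Rightarrow> complex mat) \<Rightarrow> complex mat \<Rightarrow> complex mat" where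
  "superop_tensor_id dI dO k N X = mat (dO * k) (dO * k)
     (\<lambda>(r, c). N (mat dI dI (\<lambda>(i, j). X $$ (i * k + r mod k, j * k + c mod k)))
        $$ (r div k, c div k))"

lemma superop_tensor_id_kron:
  assumes "linear_superop dI dO N" "X \<in> carrier_mat dI dI" "Y \<in> carrier_mat k k"
  shows "superop_tensor_id dI dO k N (kron X Y) = kron (N X) Y"
proof -
  have NX: "N X \<in> carrier_mat dO dO"
    using assms by (auto simp: linear_superop_def)
  have block: "mat dI dI (\<lambda>(i, j). kron X Y $$ (i * k + p, j * k + q)) = (Y $$ (p, q)) \<cdot>\<^sub>m X"
    if "p < k" "q < k" for p q
  proof (rule eq_matI)
    fix i j assume "i < dim_row ((Y $$ (p, q)) \<cdot>\<^sub>m X)" "j < dim_col ((Y $$ (p, q)) \<cdot>\<^sub>m X)"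
    then have ij: "i < dI" "j < dI" using assms by auto
    have lt: "l * k + s < dI * k" if "l < dI" "s < k" for l s
    proof -
      have "l * k + s < Suc l * k" using that by simp
      also have "\<dots> \<le> dI * k" using that by (intro mult_right_mono) auto
      finally show ?thesis .
    qed
    have "i * k + p < dI * k" "j * k + q < dI * k"
      using ij that by (auto intro: lt)
    then show "mat dI dI (\<lambda>(i, j). kron X Y $$ (i * k + p, j * k + q)) $$ (i, j) =
        ((Y $$ (p, q)) \<cdot>\<^sub>m X) $$ (i, j)"
      using ij that assms by (simp add: kron_def mult.commute)
  qed (use assms in auto)
  show ?thesis
  proof (rule eq_matI)
    fix r c assume "r < dim_row (kron (N X) Y)" "c < dim_col (kron (N X) Y)"
    then have rc: "r < dO * k" "c < dO * k" using NX assms by (auto simp: kron_def)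
    then have k: "0 < k" by (cases k) auto
    have "N ((Y $$ (r mod k, c mod k)) \<cdot>\<^sub>m X) = (Y $$ (r mod k, c mod k)) \<cdot>\<^sub>m N X"
      using assms by (auto simp: linear_superop_def)
    moreover have "r div k < dO" "c div k < dO"
      using rc by (auto simp: less_mult_imp_div_less)
    ultimately show "superop_tensor_id dI dO k N (kron X Y) $$ (r, c) = kron (N X) Y $$ (r, c)"
      using rc k NX assms block[of "r mod k" "c mod k"]
      by (simp add: superop_tensor_id_def kron_def mult.commute)
  qed (use NX assms in \<open>auto simp: superop_tensor_id_def kron_def\<close>)
qed

definition quantum_channel :: "nat \<Rightarrow> nat \<Rightarrow> (complex mat \<Rightarrow> complex mat) \<Rightarrow> bool" where
  "quantum_channel dI dO N \<longleftrightarrow> linear_superop dI dO N \<and>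
     (\<forall>k X. psd (dI * k) X \<longrightarrow> psd (dO * k) (superop_tensor_id dI dO k N X)) \<and>
     (\<forall>X \<in> carrier_mat dI dI. mtrace (N X) = mtrace X)"

definition choi :: "nat \<Rightarrow> nat \<Rightarrow> (complex mat \<Rightarrow> complex mat) \<Rightarrow> complex mat" where
  "choi dA dB N = mat (dA * dB) (dA * dB)
     (\<lambda>rc. \<Sum>i<dA. \<Sum>j<dA. kron (ketbra dA i j) (N (ketbra dA i j)) $$ rc)"

definition success_prob :: "nat \<Rightarrow> (complex mat \<Rightarrow> complex mat) \<Rightarrow> real" where
  "success_prob m M = (1 / real m) * (\<Sum>k<m. Re (mtrace (M (ketbra m k k) * ketbra m k k)))"

definition f_UA :: "nat \<Rightarrow> nat \<Rightarrow> (complex mat \<Rightarrow> complex mat) \<Rightarrow> nat \<Rightarrow> real" where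
  "f_UA dA dB N m = Sup {success_prob m (D \<circ> N \<circ> E) | E D.
     quantum_channel m dA E \<and> quantum_channel dB m D}"

text \<open>
  The assisting systems have arbitrary dimensions \<open>a\<close> and \<open>b\<close>, which are positive because
  they carry a density matrix.
\<close>

definition EA_code_map :: "nat \<Rightarrow> nat \<Rightarrow> (complex mat \<Rightarrow> complex mat) \<Rightarrow> nat \<Rightarrow> nat \<Rightarrow> nat \<Rightarrow>
    complex mat \<Rightarrow> (complex mat \<Rightarrow> complex mat) \<Rightarrow> (complex mat \<Rightarrow> complex mat) \<Rightarrow>
    complex mat \<Rightarrow> complex mat" where
  "EA_code_map dA dB N m a b \<phi> E D X =
     D (superop_tensor_id dA dB b N (superop_tensor_id (m * a) dA b E (kron X \<phi>)))"

definition f_EA :: "nat \<Rightarrow> nat \<Rightarrow> (complex mat \<Rightarrow> complex mat) \<Rightarrow> nat \<Rightarrow> real" where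
  "f_EA dA dB N m = Sup {success_prob m (EA_code_map dA dB N m a b \<phi> E D) | a b \<phi> E D.
     density (a * b) \<phi> \<and> quantum_channel (m * a) dA E \<and> quantum_channel (dB * b) m D}"

definition capacity :: "nat \<Rightarrow> nat \<Rightarrow> (complex mat \<Rightarrow> complex mat) \<Rightarrow> real \<Rightarrow> ereal" where
  "capacity dA dB N \<epsilon> =
     Sup {ereal (log 2 (real m)) | m. 1 \<le> m \<and> 1 - f_UA dA dB N m \<le> \<epsilon>}"

definition capacity_E :: "nat \<Rightarrow> nat \<Rightarrow> (complex mat \<Rightarrow> complex mat) \<Rightarrow> real \<Rightarrow> ereal" where
  "capacity_E dA dB N \<epsilon> =
     Sup {ereal (log 2 (real m)) | m. 1 \<le> m \<and> 1 - f_EA dA dB N m \<le> \<epsilon>}"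

text \<open>
  The trace of \<open>choi dA dB N * F\<close> is real for feasible \<open>F\<close>, being the trace of a product of
  two Hermitian matrices.
\<close>

definition NS_feasible :: "nat \<Rightarrow> nat \<Rightarrow> (complex mat \<Rightarrow> complex mat) \<Rightarrow> real \<Rightarrow>
    complex mat \<Rightarrow> complex mat \<Rightarrow> real \<Rightarrow> bool" where
  "NS_feasible dA dB N \<epsilon> F \<rho> \<eta> \<longleftrightarrow>
     F \<in> carrier_mat (dA * dB) (dA * dB) \<and> \<rho> \<in> carrier_mat dA dA \<and>
     psd (dA * dB) F \<and> loewner_le (dA * dB) F (kron \<rho> (1\<^sub>m dB)) \<and>
     mtrace \<rho> = 1 \<and>
     ptrace_left dA dB F = complex_of_real \<eta> \<cdot>\<^sub>m 1\<^sub>m dB \<and>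
     1 - \<epsilon> \<le> Re (mtrace (choi dA dB N * F))"

definition PPT_feasible :: "nat \<Rightarrow> nat \<Rightarrow> complex mat \<Rightarrow> complex mat \<Rightarrow> bool" where
  "PPT_feasible dA dB F \<rho> \<longleftrightarrow>
     psd (dA * dB) (ptranspose_right dA dB F) \<and>
     loewner_le (dA * dB) (ptranspose_right dA dB F) (kron \<rho> (1\<^sub>m dB))"

text \<open>
  For a channel and \<open>0 \<le> \<epsilon> < 1\<close> both programs are feasible and their minima are attained
  and positive, so \<open>Inf\<close> below is the minimum.
\<close>

definition capacity_NS :: "nat \<Rightarrow> nat \<Rightarrow> (complex mat \<Rightarrow> complex mat) \<Rightarrow> real \<Rightarrow> real" where
  "capacity_NS dA dB N \<epsilon> = - log 2 (Inf {\<eta>. \<exists>F \<rho>. NS_feasible dA dB N \<epsilon> F \<rho> \<eta>})"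

definition capacity_NS_PPT :: "nat \<Rightarrow> nat \<Rightarrow> (complex mat \<Rightarrow> complex mat) \<Rightarrow> real \<Rightarrow> real" where
  "capacity_NS_PPT dA dB N \<epsilon> =
     - log 2 (Inf {\<eta>. \<exists>F \<rho>. NS_feasible dA dB N \<epsilon> F \<rho> \<eta> \<and> PPT_feasible dA dB F \<rho>})"

end

theory Submission
  imports Defs
begin

text \<open>
  For a code with \<open>m\<close> messages let \<open>\<sigma>\<^sub>k\<close> be the state of the channel input and the receiver's share
  of the assistance after encoding \<open>k\<close>, and let \<open>\<Lambda>\<^sub>k\<close> be the decoder's effect for outcome \<open>k\<close>.
  The averaged link product \<open>F = (1/m) \<Sum>\<^sub>k \<sigma>\<^sub>k \<star> \<Lambda>\<^sub>k\<close>, contracted over the receiver's share and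
  transposed on the channel input, satisfies \<open>Tr (J\<^sub>N F) = \<close> success probability.  It is positive, and
  replacing \<open>\<Lambda>\<^sub>k\<close> by \<open>1 - \<Lambda>\<^sub>k\<close> gives \<open>\<rho> \<otimes> 1 - F\<close>, where \<open>\<rho>\<close> is the transpose of the average input
  state.  Summing \<open>\<Lambda>\<^sub>k\<close> to the identity yields \<open>Tr\<^sub>A F = 1/m\<close>.  Without assistance,
  partial transposition of \<open>F\<close> just replaces \<open>\<Lambda>\<^sub>k\<close> by its transpose, so the PPT conditions hold as
  well.  Since the optimal success probability is only a supremum, one obtains points that are
  feasible for every error larger than \<open>\<epsilon>\<close>, and a compactness argument gives one for \<open>\<epsilon>\<close> itself.
\<close>

section \<open>Positive semidefinite kernels\<close>

text \<open>Kernels on an arbitrary index set stand in for matrices, so that a bipartite operator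
  can be indexed by pairs rather than by \<open>i * e + k\<close>.\<close>

definition qform :: "'i set \<Rightarrow> ('i \<Rightarrow> 'i \<Rightarrow> complex) \<Rightarrow> ('i \<Rightarrow> complex) \<Rightarrow> complex" where
  "qform S K v = (\<Sum>i\<in>S. \<Sum>j\<in>S. cnj (v i) * K i j * v j)"

definition pos_kernel :: "'i set \<Rightarrow> ('i \<Rightarrow> 'i \<Rightarrow> complex) \<Rightarrow> bool" where
  "pos_kernel S K \<longleftrightarrow> (\<forall>i\<in>S. \<forall>j\<in>S. K j i = cnj (K i j)) \<and> (\<forall>v. 0 \<le> Re (qform S K v))"

lemma qform_cong:
  assumes "\<And>i. i \<in> S \<Longrightarrow> v i = w i" "\<And>i j. i \<in> S \<Longrightarrow> j \<in> S \<Longrightarrow> K i j = L i j"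
  shows "qform S K v = qform S L w"
  unfolding qform_def using assms by (intro sum.cong) auto

lemma pos_kernel_cong:
  assumes "\<And>i j. i \<in> S \<Longrightarrow> j \<in> S \<Longrightarrow> K i j = L i j"
  shows "pos_kernel S K \<longleftrightarrow> pos_kernel S L"
proof -
  have "qform S K v = qform S L v" for v using assms by (intro qform_cong) auto
  then show ?thesis unfolding pos_kernel_def by (simp add: assms cong: ball_cong)
qed

lemma pos_kernelI:
  assumes "\<And>i j. i \<in> S \<Longrightarrow> j \<in> S \<Longrightarrow> K j i = cnj (K i j)" "\<And>v. 0 \<le> Re (qform S K v)"
  shows "pos_kernel S K"
  using assms unfolding pos_kernel_def by blast

lemma pos_kernelD:
  assumes "pos_kernel S K"
  shows "i \<in> S \<Longrightarrow> j \<in> S \<Longrightarrow> K j i = cnj (K i j)" "0 \<le> Re (qform S K v)"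
  using assms unfolding pos_kernel_def by blast+

lemma pos_kernel_sum:
  assumes "\<And>k. k \<in> T \<Longrightarrow> pos_kernel S (K k)"
  shows "pos_kernel S (\<lambda>i j. \<Sum>k\<in>T. K k i j)"
proof -
  have "qform S (\<lambda>i j. \<Sum>k\<in>T. K k i j) v = (\<Sum>k\<in>T. qform S (K k) v)" for v
  proof -
    have "qform S (\<lambda>i j. \<Sum>k\<in>T. K k i j) v = (\<Sum>i\<in>S. \<Sum>j\<in>S. \<Sum>k\<in>T. cnj (v i) * K k i j * v j)"
      by (simp add: qform_def sum_distrib_left sum_distrib_right)
    also have "\<dots> = (\<Sum>i\<in>S. \<Sum>k\<in>T. \<Sum>j\<in>S. cnj (v i) * K k i j * v j)"
      by (rule sum.cong[OF refl], rule sum.swap)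
    also have "\<dots> = (\<Sum>k\<in>T. qform S (K k) v)"
      unfolding qform_def by (rule sum.swap)
    finally show ?thesis .
  qed
  then show ?thesis
    by (intro pos_kernelI) (simp_all add: pos_kernelD(1)[OF assms, symmetric] pos_kernelD(2)[OF assms] sum_nonneg)
qed

lemma pos_kernel_scale:
  assumes "pos_kernel S K" "0 \<le> c"
  shows "pos_kernel S (\<lambda>i j. of_real c * K i j)"
proof -
  have "qform S (\<lambda>i j. of_real c * K i j) v = of_real c * qform S K v" for v
    by (simp add: qform_def sum_distrib_left mult_ac)
  then show ?thesis
    using assms(2)
    by (intro pos_kernelI) (simp_all add: pos_kernelD(1)[OF assms(1), symmetric] pos_kernelD(2)[OF assms(1)])
qed

lemma pos_kernel_transpose:
  assumes "pos_kernel S K"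
  shows "pos_kernel S (\<lambda>i j. K j i)"
proof -
  have "qform S (\<lambda>i j. K j i) v = qform S K (\<lambda>i. cnj (v i))" for v
    unfolding qform_def by (subst sum.swap) (simp add: mult_ac)
  then show ?thesis 
    by (intro pos_kernelI) (simp_all add: pos_kernelD(1)[OF assms, symmetric] pos_kernelD(2)[OF assms])
qed

text \<open>With \<open>w\<close> read as a matrix, the new kernel is the congruence of
  \<open>K\<close> by \<open>w\<close>; its form at \<open>v\<close> is the form of \<open>K\<close>
  at the image of \<open>v\<close> under \<open>w\<close>.\<close>

lemma pos_kernel_congruence:
  assumes K: "pos_kernel T K"
  shows "pos_kernel S (\<lambda>x y. \<Sum>t\<in>T. \<Sum>u\<in>T. cnj (w t x) * K t u * w u y)"
proof -
  have q: "qform S (\<lambda>x y. \<Sum>t\<in>T. \<Sum>u\<in>T. cnj (w t x) * K t u * w u y) v =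
      qform T K (\<lambda>t. \<Sum>x\<in>S. w t x * v x)" for v
  proof -
    have "qform S (\<lambda>x y. \<Sum>t\<in>T. \<Sum>u\<in>T. cnj (w t x) * K t u * w u y) v =
        (\<Sum>x\<in>S. \<Sum>y\<in>S. \<Sum>t\<in>T. \<Sum>u\<in>T. cnj (w t x * v x) * K t u * (w u y * v y))"
      by (simp add: qform_def sum_distrib_left sum_distrib_right mult_ac)
    also have "\<dots> = (\<Sum>x\<in>S. \<Sum>t\<in>T. \<Sum>y\<in>S. \<Sum>u\<in>T. cnj (w t x * v x) * K t u * (w u y * v y))"
      by (rule sum.cong[OF refl], rule sum.swap)
    also have "\<dots> = (\<Sum>x\<in>S. \<Sum>t\<in>T. \<Sum>u\<in>T. \<Sum>y\<in>S. cnj (w t x * v x) * K t u * (w u y * v y))"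
      by (rule sum.cong[OF refl], rule sum.cong[OF refl], rule sum.swap)
    also have "\<dots> = (\<Sum>t\<in>T. \<Sum>x\<in>S. \<Sum>u\<in>T. \<Sum>y\<in>S. cnj (w t x * v x) * K t u * (w u y * v y))"
      by (rule sum.swap)
    also have "\<dots> = (\<Sum>t\<in>T. \<Sum>u\<in>T. \<Sum>x\<in>S. \<Sum>y\<in>S. cnj (w t x * v x) * K t u * (w u y * v y))"
      by (rule sum.cong[OF refl], rule sum.swap)
    also have "\<dots> = qform T K (\<lambda>t. \<Sum>x\<in>S. w t x * v x)"
      by (simp add: qform_def sum_distrib_left sum_distrib_right mult_ac)
    finally show ?thesis .
  qed
  have h: "(\<Sum>t\<in>T. \<Sum>u\<in>T. cnj (w t y) * K t u * w u x) =
      cnj (\<Sum>t\<in>T. \<Sum>u\<in>T. cnj (w t x) * K t u * w u y)" for x y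
  proof -
    have "cnj (\<Sum>t\<in>T. \<Sum>u\<in>T. cnj (w t x) * K t u * w u y) =
        (\<Sum>t\<in>T. \<Sum>u\<in>T. cnj (w u y) * K u t * w t x)"
      unfolding cnj_sum
      by (intro sum.cong refl) (simp add: pos_kernelD(1)[OF K, symmetric] mult_ac)
    also have "\<dots> = (\<Sum>t\<in>T. \<Sum>u\<in>T. cnj (w t y) * K t u * w u x)"
      by (rule sum.swap)
    finally show ?thesis by simp
  qed
  show ?thesis
    by (rule pos_kernelI, rule h, subst q, rule pos_kernelD(2)[OF K])
qed

text \<open>Congruence by the 0/1 matrix of the partial map \<open>h\<close>. This covers
  restriction to a subset, embedding as a block of a larger kernel and, starting from the constant
  kernel on one point, rank-one kernels of 0/1 vectors.\<close>

lemma pos_kernel_pullback: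
  assumes K: "pos_kernel T K" and T: "finite T" and h: "\<And>x. x \<in> S \<Longrightarrow> P x \<Longrightarrow> h x \<in> T"
  shows "pos_kernel S (\<lambda>x y. if P x \<and> P y then K (h x) (h y) else 0)"
proof -
  define w where "w t x = (if P x \<and> t = h x then 1 else 0 :: complex)" for t x
  have "(\<Sum>t\<in>T. \<Sum>u\<in>T. cnj (w t x) * K t u * w u y) = (if P x \<and> P y then K (h x) (h y) else 0)"
    if "x \<in> S" "y \<in> S" for x y
  proof (cases "P x \<and> P y")
    case True
    then have "(\<Sum>t\<in>T. \<Sum>u\<in>T. cnj (w t x) * K t u * w u y) =
        (\<Sum>t\<in>T. \<Sum>u\<in>T. if t = h x then (if u = h y then K t u else 0) else 0)"
      by (intro sum.cong) (auto simp: w_def)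
    also have "\<dots> = (\<Sum>t\<in>T. if t = h x then K t (h y) else 0)"
      using T h True that by (intro sum.cong) auto
    finally show ?thesis using T h True that by simp
  qed (auto simp: w_def)
  then show ?thesis
    using pos_kernel_congruence[OF K, of S w] by (subst (asm) pos_kernel_cong) auto
qed

lemma pos_kernel_subset:
  assumes "pos_kernel T K" "finite T" "S \<subseteq> T"
  shows "pos_kernel S K"
  using pos_kernel_pullback[of T K S "\<lambda>_. True" "\<lambda>x. x"] assms by auto

lemma pos_kernel_bij:
  assumes "bij_betw h S T"
  shows "pos_kernel S (\<lambda>x y. K (h x) (h y)) \<longleftrightarrow> pos_kernel T K"
proof -
  have q: "qform T K v = qform S (\<lambda>x y. K (h x) (h y)) (\<lambda>x. v (h x))" for v
    unfolding qform_def using assms by (simp add: sum.reindex_bij_betw[symmetric])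
  have "qform S (\<lambda>x y. K (h x) (h y)) v = qform T K (\<lambda>t. v (the_inv_into S h t))" for v
    unfolding q by (intro qform_cong)
      (use assms in \<open>auto simp: bij_betw_def the_inv_into_f_f\<close>)
  moreover have "(\<forall>i\<in>T. \<forall>j\<in>T. K j i = cnj (K i j)) \<longleftrightarrow> (\<forall>x\<in>S. \<forall>y\<in>S. K (h y) (h x) = cnj (K (h x) (h y)))"
    using assms unfolding bij_betw_def by blast
  ultimately show ?thesis
    using q unfolding pos_kernel_def by metis
qed

section \<open>Diagonal bounds on entries, Cholesky factorisation and link products\<close>

lemma pos_kernel_diag:
  assumes "pos_kernel S K" "finite S" "i \<in> S"
  shows "0 \<le> Re (K i i)" "K i i = of_real (Re (K i i))"
proof -
  have "pos_kernel {i} K" by (rule pos_kernel_subset[OF assms(1,2)]) (use assms in auto)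
  from pos_kernelD(2)[OF this, of "\<lambda>_. 1"] show "0 \<le> Re (K i i)"
    by (simp add: qform_def)
  show "K i i = of_real (Re (K i i))"
    using arg_cong[OF pos_kernelD(1)[OF assms(1,3,3)], of Im] by (simp add: complex_eq_iff)
qed

text \<open>The form at a vector supported on the two indices \<open>i\<close> and \<open>j\<close>;
  choices of \<open>\<alpha>\<close> and \<open>\<beta>\<close> yield the entry bounds that
  follow.\<close>

lemma pos_kernel_pair:
  assumes "pos_kernel S K" "finite S" "i \<in> S" "j \<in> S" "i \<noteq> j"
  shows "0 \<le> (cmod \<alpha>)\<^sup>2 * Re (K i i) + (cmod \<beta>)\<^sup>2 * Re (K j j) + 2 * Re (cnj \<alpha> * K i j * \<beta>)"
proof -
  have "pos_kernel {i, j} K" by (rule pos_kernel_subset[OF assms(1,2)]) (use assms in auto)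
  from pos_kernelD(2)[OF this, of "\<lambda>k. if k = i then \<alpha> else \<beta>"]
  have "0 \<le> Re (cnj \<alpha> * K i i * \<alpha> + cnj \<alpha> * K i j * \<beta> + (cnj \<beta> * K j i * \<alpha> + cnj \<beta> * K j j * \<beta>))"
    using assms(5) by (simp add: qform_def)
  moreover have "cnj \<beta> * K j i * \<alpha> = cnj (cnj \<alpha> * K i j * \<beta>)"
    unfolding pos_kernelD(1)[OF assms(1,3,4)] by (simp del: times_complex.sel)
  moreover have "Re (cnj \<alpha> * K i i * \<alpha>) = (cmod \<alpha>)\<^sup>2 * Re (K i i)"
    using pos_kernel_diag(2)[OF assms(1,2,3)]
    by (metis (no_types, opaque_lifting) Re_complex_of_real complex_norm_square mult.commute mult.assoc of_real_mult)
  moreover have "Re (cnj \<beta> * K j j * \<beta>) = (cmod \<beta>)\<^sup>2 * Re (K j j)"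
    using pos_kernel_diag(2)[OF assms(1,2,4)]
    by (metis (no_types, opaque_lifting) Re_complex_of_real complex_norm_square mult.commute mult.assoc of_real_mult)
  ultimately show ?thesis by (simp del: times_complex.sel complex_cnj_mult)
qed

lemma pos_kernel_entry_le_diag:
  assumes "pos_kernel S K" "finite S" "i \<in> S" "j \<in> S"
  shows "2 * cmod (K i j) \<le> Re (K i i) + Re (K j j)"
proof (cases "i = j")
  case True
  then show ?thesis
    using pos_kernel_diag[OF assms(1,2,3)] by (metis abs_of_nonneg mult_2 norm_of_real order_refl)
next
  case False
  show ?thesis
  proof (cases "K i j = 0")
    case True
    then show ?thesis using pos_kernel_diag(1)[OF assms(1,2)] assms by simp
  next
    case nz: False
    \<comment> \<open>This phase turns the cross term into minus twice the modulus of
      \<open>K i j\<close>.\<close>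
    define \<alpha> where "\<alpha> = - sgn (K i j)"
    have "cnj \<alpha> * K i j * 1 = - of_real (cmod (K i j))"
      using nz by (simp add: \<alpha>_def sgn_eq mult.commute complex_norm_square[symmetric] power2_eq_square)
    moreover have "cmod \<alpha> = 1" using nz by (simp add: \<alpha>_def norm_sgn)
    ultimately show ?thesis
      using pos_kernel_pair[OF assms False, of \<alpha> 1] by (simp del: times_complex.sel)
  qed
qed

text \<open>With a zero diagonal entry the form is affine in the coefficient at \<open>i\<close>, so
  a nonzero \<open>K i j\<close> would let it become negative.\<close>

lemma pos_kernel_zero_diag:
  assumes "pos_kernel S K" "finite S" "i \<in> S" "j \<in> S" "K i i = 0"
  shows "K i j = 0"
proof (rule ccontr)
  assume nz: "K i j \<noteq> 0"
  then have ij: "i \<noteq> j" using assms by auto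
  \<comment> \<open>Chosen so that the cross term equals \<open>- 2 * (Re (K j j) + 1)\<close>,
    which outweighs the remaining term \<open>Re (K j j)\<close>.\<close>
  define t where "t = (Re (K j j) + 1) / (cmod (K i j))\<^sup>2"
  have "cnj (- of_real t * K i j) * K i j * 1 = - of_real (t * (cmod (K i j))\<^sup>2)"
    unfolding of_real_mult complex_norm_square by simp
  then have "Re (cnj (- of_real t * K i j) * K i j * 1) = - (t * (cmod (K i j))\<^sup>2)"
    by (simp only: uminus_complex.sel Re_complex_of_real)
  with pos_kernel_pair[OF assms(1-4) ij, of "- of_real t * K i j" 1]
  have "0 \<le> Re (K j j) - 2 * (t * (cmod (K i j))\<^sup>2)"
    unfolding assms(5) by simp
  moreover have "t * (cmod (K i j))\<^sup>2 = Re (K j j) + 1" using nz by (simp add: t_def)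
  moreover have "0 \<le> Re (K j j)" by (rule pos_kernel_diag(1)[OF assms(1,2,4)])
  ultimately show False by simp
qed

text \<open>Cholesky elimination of one index at a time; if the pivot \<open>K x x\<close> is zero, then so are its
  row and column, and the correction term vanishes because \<open>z / 0 = 0\<close>.\<close>

lemma pos_kernel_decompose:
  assumes "finite S" "pos_kernel S K"
  shows "\<exists>s. \<forall>i\<in>S. \<forall>j\<in>S. K i j = (\<Sum>l\<in>S. s l i * cnj (s l j))"
  using assms
proof (induction S arbitrary: K rule: finite_induct)
  case (insert x S)
  note K = insert.prems
  have fin: "finite (insert x S)" using insert by simp
  define a where "a = Re (K x x)"
  have a: "K x x = of_real a" "0 \<le> a" using pos_kernel_diag[OF K fin, of x] by (auto simp: a_def)
  define K' where "K' i j = K i j - K i x * K x j / K x x" for i j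
  have "pos_kernel S K'"
  proof (cases "K x x = 0")
    case True
    then have "K' = K" by (intro ext) (simp add: K'_def)
    then show ?thesis using pos_kernel_subset[OF K fin subset_insertI] by simp
  next
    case False
    \<comment> \<open>Completing the square: the form of the Schur complement \<open>K'\<close> at
      \<open>v\<close> is the form of \<open>K\<close> at \<open>v\<close> extended by the
      minimising coordinate at \<open>x\<close>.\<close>
    have q: "qform S K' v = qform (insert x S) K (v(x := - (\<Sum>j\<in>S. K x j * v j) / K x x))" for v
    proof -
      define r where "r = (\<Sum>j\<in>S. K x j * v j)"
      define l where "l = (\<Sum>i\<in>S. cnj (v i) * K i x)"
      have l: "cnj r = l" unfolding r_def l_def
        unfolding cnj_sum by (intro sum.cong refl)
          (simp add: pos_kernelD(1)[OF K, of x, symmetric] mult.commute)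
      have "qform S K' v = qform S K v - (\<Sum>i\<in>S. \<Sum>j\<in>S. (cnj (v i) * K i x) * (K x j * v j) / K x x)"
        by (simp add: qform_def K'_def sum_subtractf algebra_simps)
      also have "(\<Sum>i\<in>S. \<Sum>j\<in>S. (cnj (v i) * K i x) * (K x j * v j) / K x x) = l * r / K x x"
        unfolding l_def r_def by (simp add: sum_product sum_divide_distrib)
      finally have 1: "qform S K' v = qform S K v - l * r / K x x" .
      define u where "u = v(x := - r / K x x)"
      have ux: "u x = - r / K x x" by (simp add: u_def)
      have u: "u i = v i" if "i \<in> S" for i using that insert(2) by (auto simp: u_def)
      have "qform (insert x S) K u =
          cnj (u x) * K x x * u x + cnj (u x) * (\<Sum>j\<in>S. K x j * u j)
          + ((\<Sum>i\<in>S. cnj (u i) * K i x) * u x + qform S K u)"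
        using insert(1,2)
        by (simp add: qform_def sum.distrib sum_distrib_left sum_distrib_right mult.assoc)
      also have "\<dots> = cnj (u x) * K x x * u x + cnj (u x) * r + (l * u x + qform S K v)"
        unfolding r_def l_def using u by (simp add: qform_def)
      also have "\<dots> = qform S K v - l * r / K x x"
        using False by (simp add: ux l a(1) field_simps)
      finally show ?thesis using 1 by (simp add: u_def r_def)
    qed
    have h: "K' j i = cnj (K' i j)" if "i \<in> S" "j \<in> S" for i j
    proof -
      have "K j x = cnj (K x j)" "K x i = cnj (K i x)" "K j i = cnj (K i j)"
        by (rule pos_kernelD(1)[OF K]; use that in simp)+
      moreover have "cnj (K x x) = K x x" by (simp add: a(1))
      ultimately show ?thesis by (simp add: K'_def mult.commute)
    qed
    show ?thesis by (rule pos_kernelI, rule h, assumption+, subst q, rule pos_kernelD(2)[OF K])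
  qed
  from insert.IH[OF this] obtain s where
    s: "\<And>i j. i \<in> S \<Longrightarrow> j \<in> S \<Longrightarrow> K' i j = (\<Sum>l\<in>S. s l i * cnj (s l j))" by blast
  \<comment> \<open>Row \<open>x\<close> of the new factor is the pivot column divided by the square
    root of the pivot; the rows from \<open>S\<close> vanish at \<open>x\<close> and factor the
    Schur complement.\<close>
  define s' where "s' l i = (if l = x then K i x / of_real (sqrt a) else if i = x then 0 else s l i)" for l i
  have "K i j = (\<Sum>l\<in>insert x S. s' l i * cnj (s' l j))" if ij: "i \<in> insert x S" "j \<in> insert x S" for i j
  proof -
    have Kjx: "cnj (K j x) = K x j" using pos_kernelD(1)[OF K ij(2), of x] by (metis complex_cnj_cnj insertI1)
    have "s' x i * cnj (s' x j) = K i x * K x j / K x x"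
      using a Kjx by (simp add: s'_def flip: of_real_mult)
    moreover have "(\<Sum>l\<in>S. s' l i * cnj (s' l j)) = (if i = x \<or> j = x then 0 else K' i j)"
    proof (cases "i = x \<or> j = x")
      case True
      then have "s' l i * cnj (s' l j) = 0" if "l \<in> S" for l
        using that insert(2) by (auto simp: s'_def)
      with True show ?thesis by simp
    next
      case False
      then show ?thesis using s[of i j] ij insert(2) by (auto simp: s'_def intro!: sum.cong)
    qed
    moreover have "K i x * K x j / K x x = K i j" if "i = x \<or> j = x"
    proof (cases "K x x = 0")
      case True
      have "K x y = 0" "K y x = 0" if "y \<in> insert x S" for y
        using pos_kernel_zero_diag[OF K fin _ that True] pos_kernelD(1)[OF K _ that, of x]
        by (metis insertI1 complex_cnj_zero)+
      then show ?thesis using that ij True by auto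
    qed (use that in auto)
    ultimately show ?thesis using insert(1,2) by (auto simp: K'_def)
  qed
  then show ?case by blast
qed auto

text \<open>The kernel is \<open>Tr\<^sub>Q[(\<sigma>\<^sup>T \<otimes> 1\<^sub>B) (1\<^sub>A \<otimes> \<Lambda>)]\<close>, where the transpose acts on \<open>A\<close> only.\<close>

lemma pos_kernel_link:
  fixes A :: "'a set" and B :: "'b set" and Q :: "'q set"
  assumes fin: "finite A" "finite B" "finite Q"
    and \<sigma>: "pos_kernel (A \<times> Q) \<sigma>" and \<Lambda>: "pos_kernel (B \<times> Q) \<Lambda>"
  shows "pos_kernel (A \<times> B)
    (\<lambda>(i, b) (j, c). \<Sum>p\<in>Q. \<Sum>q\<in>Q. \<sigma> (j, q) (i, p) * \<Lambda> (b, p) (c, q))"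
proof -
  obtain s where s: "\<And>x y. x \<in> A \<times> Q \<Longrightarrow> y \<in> A \<times> Q \<Longrightarrow> \<sigma> x y = (\<Sum>l\<in>A \<times> Q. s l x * cnj (s l y))"
    using pos_kernel_decompose[OF _ \<sigma>] fin by auto
  \<comment> \<open>Each rank-one summand of \<open>\<sigma>\<close> contributes the congruence of
    \<open>\<Lambda>\<close> by \<open>w l\<close>, which acts as the identity on \<open>B\<close>;
    the link kernel is the sum of these over \<open>l\<close>.\<close>
  define w where "w l = (\<lambda>(c' :: 'b, q) (j, c). if c' = c then s l (j, q) else 0)" for l
  have "(case x of (i, b) \<Rightarrow> \<lambda>(j, c). \<Sum>p\<in>Q. \<Sum>q\<in>Q. \<sigma> (j, q) (i, p) * \<Lambda> (b, p) (c, q)) y =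
     (\<Sum>l\<in>A \<times> Q. \<Sum>t\<in>B \<times> Q. \<Sum>u\<in>B \<times> Q. cnj (w l t x) * \<Lambda> t u * w l u y)"
    if "x \<in> A \<times> B" "y \<in> A \<times> B" for x y
  proof -
    obtain i b where x: "x = (i, b)" "i \<in> A" "b \<in> B" using \<open>x \<in> A \<times> B\<close> by blast
    obtain j c where y: "y = (j, c)" "j \<in> A" "c \<in> B" using \<open>y \<in> A \<times> B\<close> by blast
    note xy = x(1) y(1) x(2,3) y(2,3)
    have "(\<Sum>l\<in>A \<times> Q. \<Sum>t\<in>B \<times> Q. \<Sum>u\<in>B \<times> Q. cnj (w l t x) * \<Lambda> t u * w l u y) =
      (\<Sum>l\<in>A \<times> Q. \<Sum>b'\<in>B. \<Sum>p\<in>Q. \<Sum>c'\<in>B. \<Sum>q\<in>Q. cnj (w l (b', p) x) * \<Lambda> (b', p) (c', q) * w l (c', q) y)"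
      by (simp add: sum.cartesian_product')
    also have "\<dots> = (\<Sum>l\<in>A \<times> Q. \<Sum>b'\<in>B. if b' = b then
        (\<Sum>p\<in>Q. \<Sum>c'\<in>B. if c' = c then (\<Sum>q\<in>Q. cnj (s l (i, p)) * \<Lambda> (b, p) (c, q) * s l (j, q)) else 0) else 0)"
      by (intro sum.cong refl) (auto simp: w_def xy(1,2) intro!: sum.cong sum.neutral)
    also have "\<dots> = (\<Sum>l\<in>A \<times> Q. \<Sum>p\<in>Q. \<Sum>q\<in>Q. cnj (s l (i, p)) * \<Lambda> (b, p) (c, q) * s l (j, q))"
      using fin xy by simp
    also have "\<dots> = (\<Sum>p\<in>Q. \<Sum>l\<in>A \<times> Q. \<Sum>q\<in>Q. cnj (s l (i, p)) * \<Lambda> (b, p) (c, q) * s l (j, q))"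
      by (rule sum.swap)
    also have "\<dots> = (\<Sum>p\<in>Q. \<Sum>q\<in>Q. \<Sum>l\<in>A \<times> Q. cnj (s l (i, p)) * \<Lambda> (b, p) (c, q) * s l (j, q))"
      by (rule sum.cong[OF refl], rule sum.swap)
    also have "\<dots> = (\<Sum>p\<in>Q. \<Sum>q\<in>Q. \<sigma> (j, q) (i, p) * \<Lambda> (b, p) (c, q))"
      using xy by (intro sum.cong refl) (simp add: s sum_distrib_left sum_distrib_right mult_ac)
    finally show ?thesis by (simp add: xy)
  qed
  then show ?thesis
    by (subst pos_kernel_cong, assumption) (intro pos_kernel_sum pos_kernel_congruence \<Lambda>)
qed

section \<open>Matrices and channels\<close>

lemma pair_index_less:
  fixes a b :: nat
  assumes "i < a" "k < b"
  shows "i * b + k < a * b"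
proof -
  have "i * b + k < Suc i * b" using assms by simp
  also have "\<dots> \<le> a * b" using assms by (intro mult_right_mono) auto
  finally show ?thesis .
qed

lemma pair_index_bij:
  "bij_betw (\<lambda>(i, k). i * b + k) ({..<a} \<times> {..<b}) {..<a * b :: nat}"
proof (rule bij_betw_byWitness[where f' = "\<lambda>r. (r div b, r mod b)"])
  show "\<forall>x\<in>{..<a} \<times> {..<b}. ((case x of (i, k) \<Rightarrow> i * b + k) div b, (case x of (i, k) \<Rightarrow> i * b + k) mod b) = x"
    by auto
  show "\<forall>r\<in>{..<a * b}. (case (r div b, r mod b) of (i, k) \<Rightarrow> i * b + k) = r" by simp
  show "(\<lambda>(i, k). i * b + k) ` ({..<a} \<times> {..<b}) \<subseteq> {..<a * b}" by (auto intro: pair_index_less)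
  show "(\<lambda>r. (r div b, r mod b)) ` {..<a * b} \<subseteq> {..<a} \<times> {..<b}"
    by (auto simp: less_mult_imp_div_less) (metis mod_less_divisor mult_0_right neq0_conv not_less_zero)
qed

lemma sum_pair_index:
  fixes a b :: nat
  shows "(\<Sum>r<a * b. f r) = (\<Sum>i<a. \<Sum>k<b. f (i * b + k))"
  using sum.reindex_bij_betw[OF pair_index_bij, of f b a]
  by (simp add: sum.cartesian_product case_prod_unfold)

lemma mat_adjoint_eq_iff:
  assumes "A \<in> carrier_mat d d"
  shows "mat_adjoint A = A \<longleftrightarrow> (\<forall>i<d. \<forall>j<d. A $$ (j, i) = cnj (A $$ (i, j)))"
proof -
  have *: "mat_adjoint A $$ (j, i) = cnj (A $$ (i, j))" if "i < d" "j < d" for i j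
    using assms that by (simp add: mat_adjoint_def mat_of_rows_def)
  have "dim_row (mat_adjoint A) = d" "dim_col (mat_adjoint A) = d"
    using assms by (auto simp: mat_adjoint_def)
  then have "(\<forall>i<d. \<forall>j<d. mat_adjoint A $$ (j, i) = A $$ (j, i)) \<Longrightarrow> mat_adjoint A = A"
    using assms by (intro eq_matI) simp_all
  then have "mat_adjoint A = A \<longleftrightarrow> (\<forall>i<d. \<forall>j<d. mat_adjoint A $$ (j, i) = A $$ (j, i))"
    by (intro iffI) (simp_all only: simp_thms)
  also have "\<dots> \<longleftrightarrow> (\<forall>i<d. \<forall>j<d. A $$ (j, i) = cnj (A $$ (i, j)))"
    by (intro all_cong1 imp_cong refl) (metis *)
  finally show ?thesis .
qed

lemma quadratic_form_eq_qform:
  assumes "A \<in> carrier_mat d d" "v \<in> carrier_vec d"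
  shows "(A *\<^sub>v v) \<bullet>c v = qform {..<d} (\<lambda>i j. A $$ (i, j)) (\<lambda>i. v $ i)"
proof -
  have "(A *\<^sub>v v) \<bullet>c v = (\<Sum>i<d. (\<Sum>j<d. A $$ (i, j) * v $ j) * cnj (v $ i))"
    using assms by (auto simp: scalar_prod_def atLeast0LessThan intro!: sum.cong)
  then show ?thesis
    by (simp add: qform_def sum_distrib_left sum_distrib_right mult_ac)
qed

lemma psd_iff_pos_kernel:
  "psd d A \<longleftrightarrow> A \<in> carrier_mat d d \<and> pos_kernel {..<d} (\<lambda>i j. A $$ (i, j))"
proof (cases "A \<in> carrier_mat d d")
  case True
  have 1: "(\<forall>v \<in> carrier_vec d. 0 \<le> Re ((A *\<^sub>v v) \<bullet>c v)) \<longleftrightarrow>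
      (\<forall>v. 0 \<le> Re (qform {..<d} (\<lambda>i j. A $$ (i, j)) v))"
  proof (intro iffI allI ballI)
    fix v :: "nat \<Rightarrow> complex"
    assume "\<forall>v \<in> carrier_vec d. 0 \<le> Re ((A *\<^sub>v v) \<bullet>c v)"
    then have "0 \<le> Re ((A *\<^sub>v vec d v) \<bullet>c vec d v)" by auto
    also have "(A *\<^sub>v vec d v) \<bullet>c vec d v = qform {..<d} (\<lambda>i j. A $$ (i, j)) v"
      unfolding quadratic_form_eq_qform[OF True vec_carrier] by (intro qform_cong) auto
    finally show "0 \<le> Re (qform {..<d} (\<lambda>i j. A $$ (i, j)) v)" .
  qed (use quadratic_form_eq_qform[OF True] in auto)
  show ?thesis
    unfolding psd_def pos_kernel_def mat_adjoint_eq_iff[OF True] 1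
    by (simp only: True simp_thms Ball_def lessThan_iff)
qed (simp add: psd_def)

lemma psd_iff_pos_kernel_pair:
  "psd (a * b) A \<longleftrightarrow> A \<in> carrier_mat (a * b) (a * b) \<and>
     pos_kernel ({..<a} \<times> {..<b}) (\<lambda>(i, k) (j, l). A $$ (i * b + k, j * b + l))"
  unfolding psd_iff_pos_kernel pos_kernel_bij[OF pair_index_bij, symmetric]
  by (simp add: case_prod_unfold)

lemma psdI:
  assumes "A \<in> carrier_mat d d" "pos_kernel {..<d} K"
    and "\<And>i j. i < d \<Longrightarrow> j < d \<Longrightarrow> A $$ (i, j) = K i j"
  shows "psd d A"
proof -
  have "pos_kernel {..<d} (\<lambda>i j. A $$ (i, j)) \<longleftrightarrow> pos_kernel {..<d} K"
    by (rule pos_kernel_cong) (simp add: assms(3))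
  with assms(1,2) show ?thesis unfolding psd_iff_pos_kernel by (simp only: simp_thms)
qed

lemma psd_pairI:
  assumes "A \<in> carrier_mat (a * b) (a * b)" "pos_kernel ({..<a} \<times> {..<b}) K"
    and "\<And>i j k l. i < a \<Longrightarrow> j < a \<Longrightarrow> k < b \<Longrightarrow> l < b \<Longrightarrow>
      A $$ (i * b + k, j * b + l) = K (i, k) (j, l)"
  shows "psd (a * b) A"
proof -
  have "pos_kernel ({..<a} \<times> {..<b}) (\<lambda>(i, k) (j, l). A $$ (i * b + k, j * b + l)) \<longleftrightarrow>
      pos_kernel ({..<a} \<times> {..<b}) K"
    by (rule pos_kernel_cong) (auto simp: assms(3))
  with assms(1,2) show ?thesis unfolding psd_iff_pos_kernel_pair by (simp only: simp_thms)
qed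

lemma psd_pairD:
  assumes "psd (a * b) A"
  shows "pos_kernel ({..<a} \<times> {..<b}) (\<lambda>(i, k) (j, l). A $$ (i * b + k, j * b + l))"
  using assms unfolding psd_iff_pos_kernel_pair by (rule conjunct2)

lemma psd_carrier: "psd d A \<Longrightarrow> A \<in> carrier_mat d d"
  by (simp add: psd_def)

lemma kron_carrier [simp]:
  "X \<in> carrier_mat a a \<Longrightarrow> Y \<in> carrier_mat b b \<Longrightarrow> kron X Y \<in> carrier_mat (a * b) (a * b)"
  by (auto simp: kron_def)

lemma kron_index:
  assumes "X \<in> carrier_mat a a" "Y \<in> carrier_mat b b" "i < a" "j < a" "k < b" "l < b"
  shows "kron X Y $$ (i * b + k, j * b + l) = X $$ (i, j) * Y $$ (k, l)"
  using assms by (simp add: kron_def pair_index_less)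

lemma ketbra_carrier [simp]: "ketbra d i j \<in> carrier_mat d d"
  by (simp add: ketbra_def)

lemma ketbra_dim [simp]: "dim_row (ketbra d i j) = d" "dim_col (ketbra d i j) = d"
  by (simp_all add: ketbra_def)

lemma ketbra_index: "r < d \<Longrightarrow> c < d \<Longrightarrow> ketbra d i j $$ (r, c) = (if r = i \<and> c = j then 1 else 0)"
  by (simp add: ketbra_def)

lemma mtrace_carrier: "A \<in> carrier_mat d d \<Longrightarrow> mtrace A = (\<Sum>i<d. A $$ (i, i))"
  by (auto simp: mtrace_def)

lemma mtrace_mult:
  assumes "A \<in> carrier_mat d d" "B \<in> carrier_mat d d"
  shows "mtrace (A * B) = (\<Sum>r<d. \<Sum>s<d. A $$ (r, s) * B $$ (s, r))"
  using assms by (auto simp: mtrace_def scalar_prod_def atLeast0LessThan intro!: sum.cong)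

lemma mtrace_mult_ketbra:
  assumes "A \<in> carrier_mat d d" "k < d"
  shows "mtrace (A * ketbra d k k) = A $$ (k, k)"
proof -
  have "mtrace (A * ketbra d k k) = (\<Sum>r<d. \<Sum>s<d. if s = k then (if r = k then A $$ (k, k) else 0) else 0)"
    unfolding mtrace_mult[OF assms(1) ketbra_carrier]
    by (intro sum.cong) (auto simp: ketbra_index)
  then show ?thesis using assms(2) by simp
qed

lemma psd_ketbra: "psd d (ketbra d k k)"
proof -
  have "pos_kernel {()} (\<lambda>_ _. 1)"
    by (intro pos_kernelI) (auto simp: qform_def)
  from pos_kernel_pullback[OF this, of "{..<d}" "\<lambda>i. i = k" "\<lambda>_. ()"]
  have "pos_kernel {..<d} (\<lambda>i j. if i = k \<and> j = k then 1 else 0)" by simp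
  then show ?thesis by (rule psdI[OF ketbra_carrier]) (simp add: ketbra_index)
qed

section \<open>Superoperators, channels and Choi matrices\<close>

lemma linear_superop_carrier:
  "linear_superop dI dO N \<Longrightarrow> X \<in> carrier_mat dI dI \<Longrightarrow> N X \<in> carrier_mat dO dO"
  by (simp add: linear_superop_def)

lemma linear_superop_expand:
  assumes N: "linear_superop dI dO N" and X: "X \<in> carrier_mat dI dI" and bc: "b < dO" "c < dO"
  shows "N X $$ (b, c) = (\<Sum>i<dI. \<Sum>j<dI. X $$ (i, j) * N (ketbra dI i j) $$ (b, c))"
proof -
  \<comment> \<open>\<open>R T\<close> is \<open>X\<close> with the entries outside \<open>T\<close>
    set to zero. Enlarging \<open>T\<close> by one pair adds a multiple of one matrix unit, so
    binary additivity and homogeneity suffice for an induction on \<open>T\<close>.\<close>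
  define R where "R T = mat dI dI (\<lambda>ij. if ij \<in> T then X $$ ij else 0)" for T
  have NR: "N (R T) $$ (b, c) = (\<Sum>(i, j)\<in>T. X $$ (i, j) * N (ketbra dI i j) $$ (b, c))"
    if "T \<subseteq> {..<dI} \<times> {..<dI}" for T
  proof -
    have "finite T" using that by (rule finite_subset) simp
    then show ?thesis using that
    proof (induction T rule: finite_induct)
      case empty
      \<comment> \<open>The zero matrix is \<open>0\<close> times itself, so homogeneity forces its
        image to be zero.\<close>
      have "R {} = 0 \<cdot>\<^sub>m R {}" by (auto simp: R_def)
      then have "N (R {}) = 0 \<cdot>\<^sub>m N (R {})"
        using N unfolding linear_superop_def by (metis R_def mat_carrier)
      moreover have "N (R {}) \<in> carrier_mat dO dO"
        using linear_superop_carrier[OF N] by (simp add: R_def)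
      ultimately have "N (R {}) $$ (b, c) = 0 * N (R {}) $$ (b, c)"
        using bc by (metis carrier_matD index_smult_mat(1))
      then show ?case by simp
    next
      case (insert x T)
      obtain i j where x: "x = (i, j)" by (cases x)
      then have ij: "i < dI" "j < dI" using insert.prems by auto
      have R: "R T \<in> carrier_mat dI dI" for T by (simp add: R_def)
      have "R (insert x T) = X $$ (i, j) \<cdot>\<^sub>m ketbra dI i j + R T"
        using insert(2) ij by (intro eq_matI) (auto simp: R_def ketbra_index x)
      then have "N (R (insert x T)) = X $$ (i, j) \<cdot>\<^sub>m N (ketbra dI i j) + N (R T)"
        using N R unfolding linear_superop_def by (metis ketbra_carrier smult_carrier_mat)
      moreover have "N (ketbra dI i j) \<in> carrier_mat dO dO" "N (R T) \<in> carrier_mat dO dO"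
        using linear_superop_carrier[OF N] R by auto
      ultimately have "N (R (insert x T)) $$ (b, c) =
          X $$ (i, j) * N (ketbra dI i j) $$ (b, c) + N (R T) $$ (b, c)"
        using bc by simp
      with insert x show ?case by simp
    qed
  qed
  have "R ({..<dI} \<times> {..<dI}) = X"
    using X by (intro eq_matI) (auto simp: R_def)
  then show ?thesis using NR[OF subset_refl] by (simp only: sum.cartesian_product)
qed

lemma superop_tensor_id_carrier [simp]:
  "superop_tensor_id dI dO k N X \<in> carrier_mat (dO * k) (dO * k)"
  by (simp add: superop_tensor_id_def)

lemma superop_tensor_id_index:
  assumes "i < dO" "j < dO" "p < k" "q < k"
  shows "superop_tensor_id dI dO k N X $$ (i * k + p, j * k + q) =
    N (mat dI dI (\<lambda>(i', j'). X $$ (i' * k + p, j' * k + q))) $$ (i, j)"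
  using assms by (simp add: superop_tensor_id_def pair_index_less)

lemma superop_tensor_id_1:
  assumes "linear_superop dI dO N" "X \<in> carrier_mat dI dI"
  shows "superop_tensor_id dI dO 1 N X = N X"
proof -
  have "mat dI dI (\<lambda>(i, j). X $$ (i, j)) = X" using assms(2) by auto
  then show ?thesis
    using linear_superop_carrier[OF assms] by (auto simp: superop_tensor_id_def intro!: eq_matI)
qed

lemma quantum_channelD:
  assumes "quantum_channel dI dO N"
  shows "linear_superop dI dO N"
    and "psd (dI * k) X \<Longrightarrow> psd (dO * k) (superop_tensor_id dI dO k N X)"
    and "Y \<in> carrier_mat dI dI \<Longrightarrow> mtrace (N Y) = mtrace Y"
  using assms by (auto simp: quantum_channel_def)

lemma quantum_channel_psd:
  assumes "quantum_channel dI dO N" "psd dI X"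
  shows "psd dO (N X)"
  using quantum_channelD(2)[OF assms(1), of 1 X] assms(2)
    superop_tensor_id_1[OF quantum_channelD(1)[OF assms(1)] psd_carrier[OF assms(2)]]
  by simp

text \<open>Complete positivity applied to the (unnormalised) maximally entangled state.\<close>

lemma quantum_channel_choi_pos:
  assumes D: "quantum_channel dI dO D" and k: "k < dO"
  shows "pos_kernel {..<dI} (\<lambda>r s. D (ketbra dI r s) $$ (k, k))"
proof -
  define X where "X = mat (dI * dI) (dI * dI)
    (\<lambda>(r, c). if r div dI = r mod dI \<and> c div dI = c mod dI then 1 else 0 :: complex)"
  have "pos_kernel {()} (\<lambda>_ _. 1)"
    by (intro pos_kernelI) (auto simp: qform_def)
  from pos_kernel_pullback[OF this, of "{..<dI} \<times> {..<dI}" "\<lambda>(i, p). i = p" "\<lambda>_. ()"]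
  have "pos_kernel ({..<dI} \<times> {..<dI})
      (\<lambda>x y. if (case x of (i, p) \<Rightarrow> i = p) \<and> (case y of (i, p) \<Rightarrow> i = p) then 1 else 0)"
    by simp
  then have "psd (dI * dI) X"
    by (rule psd_pairI[rotated]) (auto simp: X_def pair_index_less)
  then have "psd (dO * dI) (superop_tensor_id dI dO dI D X)"
    by (rule quantum_channelD(2)[OF D])
  then have pos: "pos_kernel ({..<dO} \<times> {..<dI})
      (\<lambda>(i, p) (j, q). superop_tensor_id dI dO dI D X $$ (i * dI + p, j * dI + q))"
    by (rule psd_pairD)
  have *: "superop_tensor_id dI dO dI D X $$ (k * dI + p, k * dI + q) = D (ketbra dI p q) $$ (k, k)"
    if "p < dI" "q < dI" for p q
  proof -
    have "mat dI dI (\<lambda>(i', j'). X $$ (i' * dI + p, j' * dI + q)) = ketbra dI p q"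
      using that by (intro eq_matI) (auto simp: X_def pair_index_less ketbra_index)
    then show ?thesis using that k by (simp add: superop_tensor_id_index)
  qed
  from pos_kernel_pullback[OF pos, of "{..<dI}" "\<lambda>_. True" "\<lambda>p. (k, p)"]
  have "pos_kernel {..<dI}
      (\<lambda>p q. superop_tensor_id dI dO dI D X $$ (k * dI + p, k * dI + q))"
    using k by simp
  then show ?thesis by (subst (asm) pos_kernel_cong[OF *]) auto
qed

text \<open>Discarding the input and preparing the first basis state. These channels witness that
  the sets of codes are nonempty, so that their suprema can be approximated by actual codes.\<close>

lemma quantum_channel_replace:
  assumes "0 < dO"
  shows "quantum_channel dI dO (\<lambda>X. mtrace X \<cdot>\<^sub>m ketbra dO 0 0)"
  unfolding quantum_channel_def
proof (intro conjI allI ballI impI)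
  show "linear_superop dI dO (\<lambda>X. mtrace X \<cdot>\<^sub>m ketbra dO 0 0)"
    unfolding linear_superop_def
  proof (intro conjI ballI allI)
    fix X Y :: "complex mat" and c
    assume X: "X \<in> carrier_mat dI dI"
    show "mtrace X \<cdot>\<^sub>m ketbra dO 0 0 \<in> carrier_mat dO dO" by simp
    have "mtrace (c \<cdot>\<^sub>m X) = c * mtrace X"
      using X by (simp add: mtrace_carrier[where d = dI] sum_distrib_left)
    then show "mtrace (c \<cdot>\<^sub>m X) \<cdot>\<^sub>m ketbra dO 0 0 = c \<cdot>\<^sub>m (mtrace X \<cdot>\<^sub>m ketbra dO 0 0)"
      by (intro eq_matI) simp_all
    assume Y: "Y \<in> carrier_mat dI dI"
    have "mtrace (X + Y) = mtrace X + mtrace Y"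
      using X Y by (simp add: mtrace_carrier[where d = dI] sum.distrib)
    then show "mtrace (X + Y) \<cdot>\<^sub>m ketbra dO 0 0 = mtrace X \<cdot>\<^sub>m ketbra dO 0 0 + mtrace Y \<cdot>\<^sub>m ketbra dO 0 0"
      by (intro eq_matI) (simp_all add: distrib_right)
  qed
  show "mtrace (mtrace X \<cdot>\<^sub>m ketbra dO 0 0) = mtrace X" for X
  proof -
    have "mtrace (mtrace X \<cdot>\<^sub>m ketbra dO 0 0) = (\<Sum>i<dO. if i = 0 then mtrace X else 0)"
      unfolding mtrace_carrier[where d = dO, OF smult_carrier_mat[OF ketbra_carrier]]
      by (intro sum.cong refl) (simp add: ketbra_index)
    then show ?thesis using assms by simp
  qed
  fix k X
  assume X: "psd (dI * k) X"
  let ?Y = "superop_tensor_id dI dO k (\<lambda>X. mtrace X \<cdot>\<^sub>m ketbra dO 0 0) X"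
  have "pos_kernel ({..<dI} \<times> {..<k}) (\<lambda>(i, p) (j, q). X $$ (i * k + p, j * k + q))"
    using X by (rule psd_pairD)
  \<comment> \<open>The output is the partial trace over the input placed in the block of output
    index \<open>0\<close>, hence a sum over \<open>i\<close> of embedded diagonal blocks.\<close>
  then have "pos_kernel ({..<dO} \<times> {..<k}) (\<lambda>x y. if fst x = 0 \<and> fst y = 0
      then (\<lambda>(i, p) (j, q). X $$ (i * k + p, j * k + q)) (i, snd x) (i, snd y) else 0)"
    if "i < dI" for i
    by (rule pos_kernel_pullback) (use that in auto)
  then have "pos_kernel ({..<dO} \<times> {..<k}) (\<lambda>x y. \<Sum>i<dI. if fst x = 0 \<and> fst y = 0
      then (\<lambda>(i, p) (j, q). X $$ (i * k + p, j * k + q)) (i, snd x) (i, snd y) else 0)"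
    by (rule pos_kernel_sum) simp
  then show "psd (dO * k) ?Y"
    by (rule psd_pairI[OF superop_tensor_id_carrier])
      (simp add: superop_tensor_id_index mtrace_carrier[where d = dI] ketbra_index)
qed

lemma choi_carrier [simp]: "choi dA dB N \<in> carrier_mat (dA * dB) (dA * dB)"
  by (simp add: choi_def)

lemma choi_index:
  assumes "N \<in> carrier_mat dA dA \<rightarrow> carrier_mat dB dB"
    and "i < dA" "j < dA" "x < dB" "y < dB"
  shows "choi dA dB N $$ (i * dB + x, j * dB + y) = N (ketbra dA i j) $$ (x, y)"
proof -
  have "kron (ketbra dA i' j') (N (ketbra dA i' j')) $$ (i * dB + x, j * dB + y) =
      (if j' = j then (if i' = i then N (ketbra dA i j) $$ (x, y) else 0) else 0)" for i' j'
    using assms by (subst kron_index[where a = dA and b = dB]) (auto simp: ketbra_index)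
  then show ?thesis using assms by (simp add: choi_def pair_index_less)
qed

section \<open>Feasible points from codes\<close>

text \<open>
  Encoding message \<open>k\<close> leaves the channel input and the receiver's half of the assistance in the
  state \<open>\<sigma> k\<close>.  Its marginal on the receiver's side does not depend on \<open>k\<close>: this no-signalling
  property is what makes \<open>Tr\<^sub>A F\<close> proportional to the identity.
\<close>

locale code_ensemble =
  fixes dA dB b m :: nat and \<sigma> \<Lambda> :: "nat \<Rightarrow> complex mat" and \<tau> :: "complex mat"
  assumes m: "0 < m"
    and \<sigma>: "\<And>k. k < m \<Longrightarrow> psd (dA * b) (\<sigma> k)"
    and marginal: "\<And>k. k < m \<Longrightarrow> ptrace_left dA b (\<sigma> k) = \<tau>"
    and \<tau>: "mtrace \<tau> = 1"
    and \<Lambda>: "\<And>k. k < m \<Longrightarrow> psd (dB * b) (\<Lambda> k)"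
    and \<Lambda>_sum: "\<And>r s. r < dB * b \<Longrightarrow> s < dB * b \<Longrightarrow>
      (\<Sum>k<m. \<Lambda> k $$ (r, s)) = (if r = s then 1 else 0)"
begin

text \<open>The channel-input indices of \<open>\<sigma> k\<close> are swapped relative to those of
  \<open>F\<close>; the trace against the Choi matrix swaps them back. The indices \<open>p\<close>
  and \<open>q\<close> are contracted as in the trace of a product, without a transpose.\<close>

definition F :: "complex mat" where
  "F = mat (dA * dB) (dA * dB) (\<lambda>(r, s). of_real (1 / real m) * (\<Sum>k<m. \<Sum>p<b. \<Sum>q<b.
     \<sigma> k $$ ((s div dB) * b + q, (r div dB) * b + p) *
     \<Lambda> k $$ ((r mod dB) * b + p, (s mod dB) * b + q)))"

definition \<rho> :: "complex mat" where
  "\<rho> = mat dA dA (\<lambda>(i, j). of_real (1 / real m) * (\<Sum>k<m. \<Sum>q<b. \<sigma> k $$ (j * b + q, i * b + q)))"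

lemma F_carrier [simp]: "F \<in> carrier_mat (dA * dB) (dA * dB)"
  by (simp add: F_def)

lemma \<rho>_carrier [simp]: "\<rho> \<in> carrier_mat dA dA"
  by (simp add: \<rho>_def)

lemma F_index:
  assumes "i < dA" "j < dA" "x < dB" "y < dB"
  shows "F $$ (i * dB + x, j * dB + y) = of_real (1 / real m) * (\<Sum>k<m. \<Sum>p<b. \<Sum>q<b.
     \<sigma> k $$ (j * b + q, i * b + p) * \<Lambda> k $$ (x * b + p, y * b + q))"
  using assms by (simp add: F_def pair_index_less)

lemma marginal_index:
  assumes "k < m" "p < b" "q < b"
  shows "(\<Sum>i<dA. \<sigma> k $$ (i * b + p, i * b + q)) = \<tau> $$ (p, q)"
  using assms marginal[OF assms(1), symmetric] by (simp add: ptrace_left_def)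

lemma \<tau>_trace: "(\<Sum>q<b. \<tau> $$ (q, q)) = 1"
proof -
  have "dim_row \<tau> = b" using marginal[OF m] by (auto simp: ptrace_left_def)
  then show ?thesis using \<tau> by (simp add: mtrace_def)
qed

lemma \<Lambda>_sum_pair:
  assumes "x < dB" "y < dB" "p < b" "q < b"
  shows "(\<Sum>k<m. \<Lambda> k $$ (x * b + p, y * b + q)) = (if x = y \<and> p = q then 1 else 0)"
proof -
  have "x * b + p = y * b + q \<longleftrightarrow> x = y \<and> p = q"
    using bij_betw_imp_inj_on[OF pair_index_bij[of b dB]] assms
    unfolding inj_on_def by fastforce
  then show ?thesis using assms by (simp add: \<Lambda>_sum pair_index_less)
qed

text \<open>The kernel \<open>L\<close> is kept general so that it can be the effects, their
  complements or their transposes; these give \<open>F\<close>, the upper bound on \<open>F\<close>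
  and the PPT conditions.\<close>

lemma psd_average_link:
  assumes G: "G \<in> carrier_mat (dA * dB) (dA * dB)"
    and L: "\<And>k. k < m \<Longrightarrow> pos_kernel ({..<dB} \<times> {..<b}) (L k)"
    and idx: "\<And>i j x y. i < dA \<Longrightarrow> j < dA \<Longrightarrow> x < dB \<Longrightarrow> y < dB \<Longrightarrow>
      G $$ (i * dB + x, j * dB + y) = of_real (1 / real m) * (\<Sum>k<m. \<Sum>p<b. \<Sum>q<b.
        \<sigma> k $$ (j * b + q, i * b + p) * L k (x, p) (y, q))"
  shows "psd (dA * dB) G"
proof -
  let ?S = "\<lambda>k (i, p) (j, q). \<sigma> k $$ (i * b + p, j * b + q)"
  have "pos_kernel ({..<dA} \<times> {..<dB}) (\<lambda>(i, x) (j, y). \<Sum>p<b. \<Sum>q<b.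
      ?S k (j, q) (i, p) * L k (x, p) (y, q))" if "k < m" for k
    using that by (intro pos_kernel_link psd_pairD \<sigma> L) auto
  then have "pos_kernel ({..<dA} \<times> {..<dB}) (\<lambda>u v. \<Sum>k<m. (\<lambda>(i, x) (j, y). \<Sum>p<b. \<Sum>q<b.
      ?S k (j, q) (i, p) * L k (x, p) (y, q)) u v)"
    by (intro pos_kernel_sum) simp
  then have "pos_kernel ({..<dA} \<times> {..<dB}) (\<lambda>u v. of_real (1 / real m) *
      (\<Sum>k<m. (\<lambda>(i, x) (j, y). \<Sum>p<b. \<Sum>q<b. ?S k (j, q) (i, p) * L k (x, p) (y, q)) u v))"
    by (rule pos_kernel_scale) simp
  then show ?thesis
    by (rule psd_pairI[OF G]) (simp add: idx)
qed

text \<open>The complement of one effect is the sum of all the others.\<close>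

lemma pos_kernel_complement:
  assumes k: "k < m"
  shows "pos_kernel ({..<dB} \<times> {..<b})
    (\<lambda>s t. (if s = t then 1 else 0) - (\<lambda>(x, p) (y, q). \<Lambda> k $$ (x * b + p, y * b + q)) s t)"
    (is "pos_kernel _ ?K")
proof -
  let ?L = "\<lambda>k (x, p) (y, q). \<Lambda> k $$ (x * b + p, y * b + q)"
  have "pos_kernel ({..<dB} \<times> {..<b}) (\<lambda>s t. \<Sum>k'\<in>{..<m} - {k}. ?L k' s t)"
    by (intro pos_kernel_sum psd_pairD \<Lambda>) simp
  moreover have "(\<Sum>k'\<in>{..<m} - {k}. ?L k' s t) = ?K s t"
    if "s \<in> {..<dB} \<times> {..<b}" "t \<in> {..<dB} \<times> {..<b}" for s t
  proof -
    have "(\<Sum>k'<m. ?L k' s t) = (if s = t then 1 else 0)"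
      using that by (cases s; cases t) (simp add: \<Lambda>_sum_pair)
    then show ?thesis
      using k by (simp add: sum_diff1)
  qed
  ultimately show ?thesis by (subst (asm) pos_kernel_cong)
qed

text \<open>Exhibits \<open>\<rho>\<close> tensor identity as the averaged link of the
  \<open>\<sigma> k\<close> with the identity effect, so that subtracting a link with
  \<open>L\<close> leaves the link with the complement of \<open>L\<close>.\<close>

lemma kron_\<rho>_one_index:
  assumes "i < dA" "j < dA" "x < dB" "y < dB"
  shows "kron \<rho> (1\<^sub>m dB) $$ (i * dB + x, j * dB + y) = of_real (1 / real m) * (\<Sum>k<m. \<Sum>p<b. \<Sum>q<b.
     \<sigma> k $$ (j * b + q, i * b + p) * (if (x, p) = (y, q) then 1 else 0))"
proof -
  have "(\<Sum>p<b. \<Sum>q<b. \<sigma> k $$ (j * b + q, i * b + p) * (if (x, p) = (y, q) then 1 else 0)) =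
      (\<Sum>p<b. \<Sum>q<b. if q = p then (if x = y then \<sigma> k $$ (j * b + p, i * b + p) else 0) else 0)" for k
    by (intro sum.cong) auto
  moreover have "\<dots> k = (if x = y then (\<Sum>p<b. \<sigma> k $$ (j * b + p, i * b + p)) else 0)" for k
    by simp
  ultimately show ?thesis
    using assms by (simp add: kron_index[where a = dA and b = dB] \<rho>_def)
qed

lemma loewner_average_link:
  assumes G: "G \<in> carrier_mat (dA * dB) (dA * dB)"
    and L: "\<And>k. k < m \<Longrightarrow> pos_kernel ({..<dB} \<times> {..<b}) (\<lambda>s t. (if s = t then 1 else 0) - L k s t)"
    and idx: "\<And>i j x y. i < dA \<Longrightarrow> j < dA \<Longrightarrow> x < dB \<Longrightarrow> y < dB \<Longrightarrow>
      G $$ (i * dB + x, j * dB + y) = of_real (1 / real m) * (\<Sum>k<m. \<Sum>p<b. \<Sum>q<b.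
        \<sigma> k $$ (j * b + q, i * b + p) * L k (x, p) (y, q))"
  shows "loewner_le (dA * dB) G (kron \<rho> (1\<^sub>m dB))"
proof -
  have "psd (dA * dB) (kron \<rho> (1\<^sub>m dB) - G)"
  proof (rule psd_average_link[OF _ L])
    fix i j x y assume ij: "i < dA" "j < dA" "x < dB" "y < dB"
    have "(kron \<rho> (1\<^sub>m dB) - G) $$ (i * dB + x, j * dB + y) =
        kron \<rho> (1\<^sub>m dB) $$ (i * dB + x, j * dB + y) - G $$ (i * dB + x, j * dB + y)"
      using ij G by (simp add: pair_index_less)
    then show "(kron \<rho> (1\<^sub>m dB) - G) $$ (i * dB + x, j * dB + y) =
        of_real (1 / real m) * (\<Sum>k<m. \<Sum>p<b. \<Sum>q<b. \<sigma> k $$ (j * b + q, i * b + p) *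
          ((if (x, p) = (y, q) then 1 else 0) - L k (x, p) (y, q)))"
      unfolding kron_\<rho>_one_index[OF ij] idx[OF ij] right_diff_distrib sum_subtractf .
  qed (use G in \<open>auto intro: minus_carrier_mat\<close>)
  then show ?thesis using G by (simp add: loewner_le_def)
qed

lemma mtrace_\<rho>: "mtrace \<rho> = 1"
proof -
  have "mtrace \<rho> = of_real (1 / real m) * (\<Sum>i<dA. \<Sum>k<m. \<Sum>q<b. \<sigma> k $$ (i * b + q, i * b + q))"
    unfolding mtrace_carrier[OF \<rho>_carrier] sum_distrib_left by (simp add: \<rho>_def sum_distrib_left)
  also have "(\<Sum>i<dA. \<Sum>k<m. \<Sum>q<b. \<sigma> k $$ (i * b + q, i * b + q)) =
      (\<Sum>k<m. \<Sum>i<dA. \<Sum>q<b. \<sigma> k $$ (i * b + q, i * b + q))"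
    by (rule sum.swap)
  also have "\<dots> = (\<Sum>k<m. \<Sum>q<b. \<Sum>i<dA. \<sigma> k $$ (i * b + q, i * b + q))"
    by (rule sum.cong[OF refl], rule sum.swap)
  also have "\<dots> = of_nat m" by (simp add: marginal_index \<tau>_trace)
  finally show ?thesis using m by simp
qed

lemma ptrace_left_F: "ptrace_left dA dB F = complex_of_real (1 / real m) \<cdot>\<^sub>m 1\<^sub>m dB"
proof -
  have "(\<Sum>i<dA. F $$ (i * dB + x, i * dB + y)) = of_real (1 / real m) * (if x = y then 1 else 0)"
    if xy: "x < dB" "y < dB" for x y
  proof -
    have "(\<Sum>i<dA. F $$ (i * dB + x, i * dB + y)) = of_real (1 / real m) * (\<Sum>i<dA. \<Sum>k<m. \<Sum>p<b. \<Sum>q<b.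
        \<sigma> k $$ (i * b + q, i * b + p) * \<Lambda> k $$ (x * b + p, y * b + q))"
      using xy by (simp add: F_index sum_distrib_left)
    also have "(\<Sum>i<dA. \<Sum>k<m. \<Sum>p<b. \<Sum>q<b.
        \<sigma> k $$ (i * b + q, i * b + p) * \<Lambda> k $$ (x * b + p, y * b + q)) =
        (\<Sum>k<m. \<Sum>i<dA. \<Sum>p<b. \<Sum>q<b.
        \<sigma> k $$ (i * b + q, i * b + p) * \<Lambda> k $$ (x * b + p, y * b + q))"
      by (rule sum.swap)
    also have "\<dots> = (\<Sum>k<m. \<Sum>p<b. \<Sum>i<dA. \<Sum>q<b.
        \<sigma> k $$ (i * b + q, i * b + p) * \<Lambda> k $$ (x * b + p, y * b + q))"
      by (rule sum.cong[OF refl], rule sum.swap)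
    also have "\<dots> = (\<Sum>k<m. \<Sum>p<b. \<Sum>q<b. \<Sum>i<dA.
        \<sigma> k $$ (i * b + q, i * b + p) * \<Lambda> k $$ (x * b + p, y * b + q))"
      by (rule sum.cong[OF refl], rule sum.cong[OF refl], rule sum.swap)
    \<comment> \<open>No-signalling enters here: \<open>\<tau>\<close> does not depend on
      \<open>k\<close>, so the sum over \<open>k\<close> can next be applied to the effects
      alone.\<close>
    also have "\<dots> = (\<Sum>k<m. \<Sum>p<b. \<Sum>q<b. \<tau> $$ (q, p) * \<Lambda> k $$ (x * b + p, y * b + q))"
      by (simp add: marginal_index flip: sum_distrib_right)
    also have "\<dots> = (\<Sum>p<b. \<Sum>k<m. \<Sum>q<b. \<tau> $$ (q, p) * \<Lambda> k $$ (x * b + p, y * b + q))"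
      by (rule sum.swap)
    also have "\<dots> = (\<Sum>p<b. \<Sum>q<b. \<Sum>k<m. \<tau> $$ (q, p) * \<Lambda> k $$ (x * b + p, y * b + q))"
      by (rule sum.cong[OF refl], rule sum.swap)
    also have "\<dots> = (\<Sum>p<b. \<Sum>q<b. if q = p then (if x = y then \<tau> $$ (p, p) else 0) else 0)"
      using xy by (intro sum.cong refl) (auto simp: \<Lambda>_sum_pair simp flip: sum_distrib_left)
    also have "\<dots> = (if x = y then 1 else 0)" by (simp add: \<tau>_trace)
    finally show ?thesis .
  qed
  then show ?thesis by (intro eq_matI) (auto simp: ptrace_left_def)
qed

text \<open>By linearity, the sum over \<open>i\<close> and \<open>j\<close> of
  \<open>\<sigma> k\<close> entries times \<open>N (ketbra dA i j)\<close> rebuilds \<open>N\<close>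
  acting on \<open>\<sigma> k\<close>; what remains is the trace against
  \<open>\<Lambda> k\<close>.\<close>

lemma mtrace_choi_F:
  assumes N: "linear_superop dA dB N"
  shows "mtrace (choi dA dB N * F) =
    of_real (1 / real m) * (\<Sum>k<m. mtrace (superop_tensor_id dA dB b N (\<sigma> k) * \<Lambda> k))"
proof -
  let ?g = "\<lambda>k i x j y p q. N (ketbra dA i j) $$ (x, y) *
    (\<sigma> k $$ (i * b + q, j * b + p) * \<Lambda> k $$ (y * b + p, x * b + q))"
  have Nc: "N \<in> carrier_mat dA dA \<rightarrow> carrier_mat dB dB"
    using linear_superop_carrier[OF N] by auto
  have "mtrace (choi dA dB N * F) = (\<Sum>i<dA. \<Sum>x<dB. \<Sum>j<dA. \<Sum>y<dB.
      N (ketbra dA i j) $$ (x, y) * (of_real (1 / real m) * (\<Sum>k<m. \<Sum>p<b. \<Sum>q<b.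
        \<sigma> k $$ (i * b + q, j * b + p) * \<Lambda> k $$ (y * b + p, x * b + q))))"
    unfolding mtrace_mult[OF choi_carrier F_carrier] sum_pair_index
    by (intro sum.cong refl) (simp only: lessThan_iff choi_index[OF Nc] F_index)
  also have "\<dots> = of_real (1 / real m) *
      (\<Sum>i<dA. \<Sum>x<dB. \<Sum>j<dA. \<Sum>y<dB. \<Sum>k<m. \<Sum>p<b. \<Sum>q<b. ?g k i x j y p q)"
    by (simp only: sum_distrib_left mult.left_commute)
  also have "(\<Sum>i<dA. \<Sum>x<dB. \<Sum>j<dA. \<Sum>y<dB. \<Sum>k<m. \<Sum>p<b. \<Sum>q<b. ?g k i x j y p q) =
      (\<Sum>k<m. \<Sum>x<dB. \<Sum>q<b. \<Sum>y<dB. \<Sum>p<b. \<Sum>i<dA. \<Sum>j<dA. ?g k i x j y p q)"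
    \<comment> \<open>All seven sums are permuted at once by a bijection of index tuples, which
      brings together the pairs \<open>(x, q)\<close> and \<open>(y, p)\<close> that index
      \<open>B\<close> with the receiver's share.\<close>
    unfolding sum.cartesian_product
    by (rule sum.reindex_bij_witness[of _ "\<lambda>(k, x, q, y, p, i, j). (i, x, j, y, k, p, q)"
        "\<lambda>(i, x, j, y, k, p, q). (k, x, q, y, p, i, j)"]) auto
  also have "\<dots> = (\<Sum>k<m. mtrace (superop_tensor_id dA dB b N (\<sigma> k) * \<Lambda> k))"
  proof (rule sum.cong[OF refl])
    fix k assume "k \<in> {..<m}"
    then have k: "k < m" by simp
    have "superop_tensor_id dA dB b N (\<sigma> k) $$ (x * b + q, y * b + p) =
        (\<Sum>i<dA. \<Sum>j<dA. \<sigma> k $$ (i * b + q, j * b + p) * N (ketbra dA i j) $$ (x, y))"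
      if "x < dB" "q < b" "y < dB" "p < b" for x q y p
      unfolding superop_tensor_id_index[OF that(1,3,2,4)]
        linear_superop_expand[OF N mat_carrier that(1,3)]
      by simp
    then show "(\<Sum>x<dB. \<Sum>q<b. \<Sum>y<dB. \<Sum>p<b. \<Sum>i<dA. \<Sum>j<dA. ?g k i x j y p q) =
        mtrace (superop_tensor_id dA dB b N (\<sigma> k) * \<Lambda> k)"
      unfolding mtrace_mult[OF superop_tensor_id_carrier psd_carrier[OF \<Lambda>[OF k]]] sum_pair_index
      by (simp add: sum_distrib_left sum_distrib_right mult_ac)
  qed
  finally show ?thesis .
qed

lemma NS_feasible_F:
  assumes N: "linear_superop dA dB N"
    and succ: "1 - \<epsilon> \<le> 1 / real m * (\<Sum>k<m. Re (mtrace (superop_tensor_id dA dB b N (\<sigma> k) * \<Lambda> k)))"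
  shows "NS_feasible dA dB N \<epsilon> F \<rho> (1 / real m)"
  unfolding NS_feasible_def
proof (intro conjI)
  let ?L = "\<lambda>k (x, p) (y, q). \<Lambda> k $$ (x * b + p, y * b + q)"
  show "psd (dA * dB) F"
    by (rule psd_average_link[OF F_carrier, of ?L]) (auto intro!: psd_pairD \<Lambda> simp: F_index)
  show "loewner_le (dA * dB) F (kron \<rho> (1\<^sub>m dB))"
    by (rule loewner_average_link[OF F_carrier, of ?L]) (simp_all add: pos_kernel_complement F_index)
  show "1 - \<epsilon> \<le> Re (mtrace (choi dA dB N * F))"
    using succ unfolding mtrace_choi_F[OF N] by (simp flip: Re_sum)
qed (simp_all add: mtrace_\<rho> ptrace_left_F)

text \<open>Partial transposition acts on the \<open>B\<close> part of each effect. When the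
  receiver's share is one-dimensional this is the full transpose of the effect, which preserves
  positivity.\<close>

lemma PPT_feasible_F:
  assumes b: "b = 1"
  shows "PPT_feasible dA dB F \<rho>"
proof -
  let ?L = "\<lambda>k (x, p) (y, q). \<Lambda> k $$ (x * b + p, y * b + q)"
  have idx: "ptranspose_right dA dB F $$ (i * dB + x, j * dB + y) =
      of_real (1 / real m) * (\<Sum>k<m. \<Sum>p<b. \<Sum>q<b.
        \<sigma> k $$ (j * b + q, i * b + p) * (\<lambda>s t. ?L k t s) (x, p) (y, q))"
    if "i < dA" "j < dA" "x < dB" "y < dB" for i j x y
  proof -
    have "ptranspose_right dA dB F $$ (i * dB + x, j * dB + y) = F $$ (i * dB + y, j * dB + x)"
      using that by (simp add: ptranspose_right_def pair_index_less)
    also have "\<dots> = of_real (1 / real m) * (\<Sum>k<m. \<Sum>p<b. \<Sum>q<b.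
        \<sigma> k $$ (j * b + q, i * b + p) * \<Lambda> k $$ (y * b + p, x * b + q))"
      using that by (simp add: F_index)
    also have "\<dots> = of_real (1 / real m) * (\<Sum>k<m. \<Sum>p<b. \<Sum>q<b.
        \<sigma> k $$ (j * b + q, i * b + p) * (\<lambda>s t. ?L k t s) (x, p) (y, q))"
      by (intro arg_cong[where f = "\<lambda>z. _ * z"] sum.cong refl) (use b in auto)
    finally show ?thesis .
  qed
  have c: "ptranspose_right dA dB F \<in> carrier_mat (dA * dB) (dA * dB)"
    by (simp add: ptranspose_right_def)
  have "psd (dA * dB) (ptranspose_right dA dB F)"
    by (rule psd_average_link[OF c pos_kernel_transpose[OF psd_pairD[OF \<Lambda>]] idx])
  moreover have "pos_kernel ({..<dB} \<times> {..<b}) (\<lambda>s t. (if s = t then 1 else 0) - ?L k t s)"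
    if "k < m" for k
  proof -
    have "(\<lambda>s t. (if s = t then 1 else 0) - ?L k t s) = (\<lambda>s t. (if t = s then 1 else 0) - ?L k t s)"
      by (intro ext arg_cong2[where f = "(-)"] refl if_cong) auto
    then show ?thesis
      using pos_kernel_transpose[OF pos_kernel_complement[OF that]] by (simp only:)
  qed
  then have "loewner_le (dA * dB) (ptranspose_right dA dB F) (kron \<rho> (1\<^sub>m dB))"
    by (rule loewner_average_link[OF c _ idx])
  ultimately show ?thesis by (simp add: PPT_feasible_def)
qed

end

text \<open>The effect \<open>D\<^sup>\<dagger>(|k\<rangle>\<langle>k|)\<close> of the Heisenberg picture of the decoder \<open>D\<close>.\<close>

definition decoding_effect :: "nat \<Rightarrow> (complex mat \<Rightarrow> complex mat) \<Rightarrow> nat \<Rightarrow> complex mat" where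
  "decoding_effect d D k = mat d d (\<lambda>(s, r). D (ketbra d r s) $$ (k, k))"

lemma decoding_effect_carrier [simp]: "decoding_effect d D k \<in> carrier_mat d d"
  by (simp add: decoding_effect_def)

lemma psd_decoding_effect:
  assumes "quantum_channel d m D" "k < m"
  shows "psd d (decoding_effect d D k)"
  using pos_kernel_transpose[OF quantum_channel_choi_pos[OF assms]]
  by (rule psdI[OF decoding_effect_carrier]) (simp add: decoding_effect_def)

text \<open>As \<open>D\<close> preserves the trace, its adjoint is unital, and the projections onto
  the \<open>m\<close> outcomes sum to the identity.\<close>

lemma decoding_effect_sum:
  assumes D: "quantum_channel d m D" and rs: "r < d" "s < d"
  shows "(\<Sum>k<m. decoding_effect d D k $$ (r, s)) = (if r = s then 1 else 0)"
proof -
  have c: "D (ketbra d s r) \<in> carrier_mat m m"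
    using linear_superop_carrier[OF quantum_channelD(1)[OF D]] by simp
  have "(\<Sum>k<m. decoding_effect d D k $$ (r, s)) = mtrace (D (ketbra d s r))"
    using rs by (simp add: decoding_effect_def mtrace_carrier[OF c])
  also have "\<dots> = (\<Sum>i<d. ketbra d s r $$ (i, i))"
    by (simp add: quantum_channelD(3)[OF D] mtrace_carrier[OF ketbra_carrier])
  also have "\<dots> = (\<Sum>i<d. if i = r then (if r = s then 1 else 0) else 0)"
    by (intro sum.cong) (auto simp: ketbra_index)
  finally show ?thesis using rs by simp
qed

lemma mtrace_mult_decoding_effect:
  assumes D: "quantum_channel d m D" and Y: "Y \<in> carrier_mat d d" and k: "k < m"
  shows "mtrace (Y * decoding_effect d D k) = mtrace (D Y * ketbra m k k)"
proof -
  have N: "linear_superop d m D" by (rule quantum_channelD(1)[OF D])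
  have "mtrace (D Y * ketbra m k k) = D Y $$ (k, k)"
    by (rule mtrace_mult_ketbra[OF linear_superop_carrier[OF N Y] k])
  also have "\<dots> = mtrace (Y * decoding_effect d D k)"
    unfolding linear_superop_expand[OF N Y k k] mtrace_mult[OF Y decoding_effect_carrier]
    by (simp add: decoding_effect_def)
  finally show ?thesis by simp
qed

section \<open>Codes as ensembles, and the feasible points they give\<close>

lemma psd_kron_ketbra:
  assumes "psd d X"
  shows "psd (m * d) (kron (ketbra m k k) X)"
proof -
  have "pos_kernel {..<d} (\<lambda>i j. X $$ (i, j))" using assms unfolding psd_iff_pos_kernel by (rule conjunct2)
  then have "pos_kernel ({..<m} \<times> {..<d}) (\<lambda>x y. if fst x = k \<and> fst y = k then X $$ (snd x, snd y) else 0)"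
    by (rule pos_kernel_pullback) auto
  then show ?thesis
    by (rule psd_pairI[OF kron_carrier[OF ketbra_carrier psd_carrier[OF assms]]])
      (simp add: kron_index[OF ketbra_carrier psd_carrier[OF assms]] ketbra_index)
qed

text \<open>\<open>E\<close> preserves the trace of every block \<open>(p, q)\<close> of the
  receiver's share, so after encoding any message the receiver's marginal is still that of
  \<open>\<phi>\<close>.\<close>

lemma EA_code_ensemble:
  assumes m: "0 < m" and \<phi>: "density (a * b) \<phi>"
    and E: "quantum_channel (m * a) dA E" and D: "quantum_channel (dB * b) m D"
  shows "code_ensemble dA dB b m
    (\<lambda>k. superop_tensor_id (m * a) dA b E (kron (ketbra m k k) \<phi>))
    (decoding_effect (dB * b) D) (ptrace_left a b \<phi>)"
proof
  have \<phi>c: "\<phi> \<in> carrier_mat (a * b) (a * b)" and tr: "mtrace \<phi> = 1" and \<phi>p: "psd (a * b) \<phi>"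
    using \<phi> psd_carrier by (auto simp: density_def)
  show "mtrace (ptrace_left a b \<phi>) = 1"
  proof -
    have "mtrace (ptrace_left a b \<phi>) = (\<Sum>q<b. \<Sum>\<alpha><a. \<phi> $$ (\<alpha> * b + q, \<alpha> * b + q))"
      by (simp add: mtrace_def ptrace_left_def)
    also have "\<dots> = mtrace \<phi>"
      unfolding mtrace_carrier[OF \<phi>c] sum_pair_index by (rule sum.swap)
    finally show ?thesis using tr by simp
  qed
  fix k assume k: "k < m"
  show "psd (dA * b) (superop_tensor_id (m * a) dA b E (kron (ketbra m k k) \<phi>))"
    using psd_kron_ketbra[OF \<phi>p] by (intro quantum_channelD(2)[OF E]) (simp add: mult.assoc)
  show "ptrace_left dA b (superop_tensor_id (m * a) dA b E (kron (ketbra m k k) \<phi>)) = ptrace_left a b \<phi>"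
  proof (rule eq_matI)
    fix p q assume "p < dim_row (ptrace_left a b \<phi>)" "q < dim_col (ptrace_left a b \<phi>)"
    then have pq: "p < b" "q < b" by (auto simp: ptrace_left_def)
    let ?X = "mat (m * a) (m * a) (\<lambda>(i, j). kron (ketbra m k k) \<phi> $$ (i * b + p, j * b + q))"
    have EX: "E ?X \<in> carrier_mat dA dA"
      using linear_superop_carrier[OF quantum_channelD(1)[OF E]] by simp
    have "(\<Sum>i<dA. superop_tensor_id (m * a) dA b E (kron (ketbra m k k) \<phi>) $$ (i * b + p, i * b + q)) =
        mtrace (E ?X)"
      using pq by (simp add: superop_tensor_id_index mtrace_carrier[OF EX])
    also have "\<dots> = mtrace ?X" by (intro quantum_channelD(3)[OF E]) simp
    also have "\<dots> = (\<Sum>l<m. \<Sum>\<alpha><a. kron (ketbra m k k) \<phi> $$ ((l * a + \<alpha>) * b + p, (l * a + \<alpha>) * b + q))"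
      by (simp add: mtrace_def sum_pair_index pair_index_less)
    also have "\<dots> = (\<Sum>l<m. if l = k then (\<Sum>\<alpha><a. \<phi> $$ (\<alpha> * b + p, \<alpha> * b + q)) else 0)"
    proof (intro sum.cong refl)
      fix l assume l: "l \<in> {..<m}"
      have "kron (ketbra m k k) \<phi> $$ ((l * a + \<alpha>) * b + p, (l * a + \<alpha>) * b + q) =
          (if l = k then \<phi> $$ (\<alpha> * b + p, \<alpha> * b + q) else 0)" if "\<alpha> < a" for \<alpha>
      proof -
        \<comment> \<open>Regroups the three-fold tensor index: \<open>E\<close> sees message and
          sender's share together, whereas \<open>kron\<close> joins the message to the whole of
          \<open>\<phi>\<close>.\<close>
        have idx: "(l * a + \<alpha>) * b + r = l * (a * b) + (\<alpha> * b + r)" for r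
          by (simp add: algebra_simps)
        show ?thesis
          unfolding idx using l pq that
          by (subst kron_index[OF ketbra_carrier \<phi>c]) (simp_all add: pair_index_less ketbra_index)
      qed
      then show "(\<Sum>\<alpha><a. kron (ketbra m k k) \<phi> $$ ((l * a + \<alpha>) * b + p, (l * a + \<alpha>) * b + q)) =
          (if l = k then (\<Sum>\<alpha><a. \<phi> $$ (\<alpha> * b + p, \<alpha> * b + q)) else 0)" by simp
    qed
    also have "\<dots> = (\<Sum>\<alpha><a. \<phi> $$ (\<alpha> * b + p, \<alpha> * b + q))" using k by simp
    finally show "ptrace_left dA b (superop_tensor_id (m * a) dA b E (kron (ketbra m k k) \<phi>)) $$ (p, q) =
        ptrace_left a b \<phi> $$ (p, q)"
      using pq by (simp add: ptrace_left_def)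
  qed (simp_all add: ptrace_left_def)
  show "psd (dB * b) (decoding_effect (dB * b) D k)" by (rule psd_decoding_effect[OF D k])
qed (use m decoding_effect_sum[OF D] in auto)

text \<open>The receiver's share is one-dimensional, so the marginal condition reduces to the
  encoded states having trace one.\<close>

lemma UA_code_ensemble:
  assumes m: "0 < m" and E: "quantum_channel m dA E" and D: "quantum_channel dB m D"
  shows "code_ensemble dA dB 1 m (\<lambda>k. E (ketbra m k k)) (decoding_effect dB D) (1\<^sub>m 1)"
proof
  show "mtrace (1\<^sub>m 1) = 1" by (simp add: mtrace_def)
  fix k assume k: "k < m"
  show "psd (dA * 1) (E (ketbra m k k))" using quantum_channel_psd[OF E psd_ketbra] by simp
  show "psd (dB * 1) (decoding_effect dB D k)" using psd_decoding_effect[OF D k] by simp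
  have c: "E (ketbra m k k) \<in> carrier_mat dA dA"
    using linear_superop_carrier[OF quantum_channelD(1)[OF E]] by simp
  have "mtrace (E (ketbra m k k)) = (\<Sum>i<m. ketbra m k k $$ (i, i))"
    by (simp add: quantum_channelD(3)[OF E] mtrace_carrier[OF ketbra_carrier])
  also have "\<dots> = (\<Sum>i<m. if i = k then 1 else 0)" by (simp add: ketbra_index)
  finally have "(\<Sum>i<dA. E (ketbra m k k) $$ (i, i)) = 1"
    using k by (simp add: mtrace_carrier[OF c])
  then show "ptrace_left dA 1 (E (ketbra m k k)) = 1\<^sub>m 1"
    by (intro eq_matI) (simp_all add: ptrace_left_def)
qed (use m decoding_effect_sum[OF D] in auto)

lemma EA_code_feasible:
  assumes N: "quantum_channel dA dB N" and m: "0 < m" and \<phi>: "density (a * b) \<phi>"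
    and E: "quantum_channel (m * a) dA E" and D: "quantum_channel (dB * b) m D"
    and succ: "1 - \<epsilon> \<le> success_prob m (EA_code_map dA dB N m a b \<phi> E D)"
  shows "\<exists>F \<rho>. NS_feasible dA dB N \<epsilon> F \<rho> (1 / real m)"
proof -
  interpret code_ensemble dA dB b m "\<lambda>k. superop_tensor_id (m * a) dA b E (kron (ketbra m k k) \<phi>)"
    "decoding_effect (dB * b) D" "ptrace_left a b \<phi>"
    by (rule EA_code_ensemble[OF m \<phi> E D])
  have "1 - \<epsilon> \<le> 1 / real m * (\<Sum>k<m. Re (mtrace (superop_tensor_id dA dB b N
      (superop_tensor_id (m * a) dA b E (kron (ketbra m k k) \<phi>)) * decoding_effect (dB * b) D k)))"
    using succ by (simp add: success_prob_def EA_code_map_def mtrace_mult_decoding_effect[OF D])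
  from NS_feasible_F[OF quantum_channelD(1)[OF N] this] show ?thesis by blast
qed

lemma UA_code_feasible:
  assumes N: "quantum_channel dA dB N" and m: "0 < m"
    and E: "quantum_channel m dA E" and D: "quantum_channel dB m D"
    and succ: "1 - \<epsilon> \<le> success_prob m (D \<circ> N \<circ> E)"
  shows "\<exists>F \<rho>. NS_feasible dA dB N \<epsilon> F \<rho> (1 / real m) \<and> PPT_feasible dA dB F \<rho>"
proof -
  interpret code_ensemble dA dB 1 m "\<lambda>k. E (ketbra m k k)" "decoding_effect dB D" "1\<^sub>m 1"
    by (rule UA_code_ensemble[OF m E D])
  note lin = quantum_channelD(1)[OF N] quantum_channelD(1)[OF E]
  have Ec: "E (ketbra m k k) \<in> carrier_mat dA dA" for k
    by (rule linear_superop_carrier[OF lin(2) ketbra_carrier])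
  have "1 - \<epsilon> \<le> 1 / real m * (\<Sum>k<m. Re (mtrace (superop_tensor_id dA dB 1 N (E (ketbra m k k)) *
      decoding_effect dB D k)))"
    using succ unfolding superop_tensor_id_1[OF lin(1) Ec]
    by (simp add: success_prob_def mtrace_mult_decoding_effect[OF D linear_superop_carrier[OF lin(1) Ec]])
  from NS_feasible_F[OF lin(1) this] PPT_feasible_F show ?thesis by blast
qed

section \<open>Compactness of the feasible sets\<close>

text \<open>Bolzano-Weierstrass one index at a time: a monotone subsequence handles the new index,
  and the convergence already obtained survives thinning.\<close>

lemma bounded_real_families_convergent_subseq:
  fixes f :: "nat \<Rightarrow> 's \<Rightarrow> real"
  assumes "finite S" "\<And>n s. s \<in> S \<Longrightarrow> \<bar>f n s\<bar> \<le> C"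
  shows "\<exists>r. strict_mono r \<and> (\<forall>s\<in>S. convergent (\<lambda>n. f (r n) s))"
  using assms
proof (induction S rule: finite_induct)
  case empty
  show ?case using strict_mono_id by auto
next
  case (insert x S)
  then obtain r where r: "strict_mono r" "\<And>s. s \<in> S \<Longrightarrow> convergent (\<lambda>n. f (r n) s)" by auto
  obtain g where g: "strict_mono g" "monoseq (\<lambda>n. f (r (g n)) x)"
    using seq_monosub[of "\<lambda>n. f (r n) x"] by (auto simp: strict_mono_def)
  have "Bseq (\<lambda>n. f (r (g n)) x)"
    by (rule BseqI'[of _ C]) (use insert.prems in auto)
  then have "convergent (\<lambda>n. f (r (g n)) x)" by (rule Bseq_monoseq_convergent) (rule g)
  moreover have "convergent (\<lambda>n. f (r (g n)) s)" if "s \<in> S" for s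
    using convergent_subseq_convergent[OF r(2)[OF that] g(1)] by (simp add: o_def)
  ultimately show ?case
    using strict_mono_o[OF r(1) g(1)] by (auto simp: o_def)
qed

lemma bounded_complex_families_convergent_subseq:
  fixes f :: "nat \<Rightarrow> 's \<Rightarrow> complex"
  assumes "finite S" "\<And>n s. s \<in> S \<Longrightarrow> cmod (f n s) \<le> C"
  obtains r l where "strict_mono r" "\<And>s. s \<in> S \<Longrightarrow> (\<lambda>n. f (r n) s) \<longlonglongrightarrow> l s"
proof -
  \<comment> \<open>The Boolean tag selects the real or the imaginary part, so both converge along a
    common subsequence.\<close>
  define g where "g n z = (if snd z then Re (f n (fst z)) else Im (f n (fst z)))" for n z
  have "\<bar>g n z\<bar> \<le> C" if "z \<in> S \<times> UNIV" for n z
    using assms(2)[of "fst z" n] that abs_Re_le_cmod[of "f n (fst z)"] abs_Im_le_cmod[of "f n (fst z)"]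
    by (auto simp: g_def)
  then obtain r where r: "strict_mono r" "\<And>z. z \<in> S \<times> UNIV \<Longrightarrow> convergent (\<lambda>n. g (r n) z)"
    using bounded_real_families_convergent_subseq[of "S \<times> UNIV" g C] assms(1) by auto
  define l where "l s = Complex (lim (\<lambda>n. g (r n) (s, True))) (lim (\<lambda>n. g (r n) (s, False)))" for s
  have "(\<lambda>n. f (r n) s) \<longlonglongrightarrow> l s" if "s \<in> S" for s
    using r(2)[of "(s, True)"] r(2)[of "(s, False)"] that
    by (simp add: tendsto_complex_iff l_def convergent_LIMSEQ_iff) (simp add: g_def)
  with r(1) that show thesis by blast
qed

definition mat_lim :: "nat \<Rightarrow> (nat \<Rightarrow> complex mat) \<Rightarrow> complex mat \<Rightarrow> bool" where
  "mat_lim d A B \<longleftrightarrow> (\<forall>n. A n \<in> carrier_mat d d) \<and> B \<in> carrier_mat d d \<and>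
     (\<forall>i<d. \<forall>j<d. (\<lambda>n. A n $$ (i, j)) \<longlonglongrightarrow> B $$ (i, j))"

lemma mat_limD:
  assumes "mat_lim d A B"
  shows "A n \<in> carrier_mat d d" "B \<in> carrier_mat d d"
    and "i < d \<Longrightarrow> j < d \<Longrightarrow> (\<lambda>n. A n $$ (i, j)) \<longlonglongrightarrow> B $$ (i, j)"
  using assms unfolding mat_lim_def by blast+

lemma mat_lim_psd:
  assumes lim: "mat_lim d A B" and psd: "\<And>n. psd d (A n)"
  shows "psd d B"
proof -
  have pos: "pos_kernel {..<d} (\<lambda>i j. A n $$ (i, j))" for n
    using psd[of n] unfolding psd_iff_pos_kernel by (rule conjunct2)
  have "pos_kernel {..<d} (\<lambda>i j. B $$ (i, j))"
  proof (rule pos_kernelI)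
    fix i j assume ij: "i \<in> {..<d}" "j \<in> {..<d}"
    have "(\<lambda>n. cnj (A n $$ (i, j))) \<longlonglongrightarrow> cnj (B $$ (i, j))"
      using ij by (intro tendsto_intros mat_limD(3)[OF lim]) auto
    then have "(\<lambda>n. A n $$ (j, i)) \<longlonglongrightarrow> cnj (B $$ (i, j))"
      unfolding pos_kernelD(1)[OF pos ij, symmetric] .
    moreover have "(\<lambda>n. A n $$ (j, i)) \<longlonglongrightarrow> B $$ (j, i)"
      using ij by (intro mat_limD(3)[OF lim]) auto
    ultimately show "B $$ (j, i) = cnj (B $$ (i, j))" by (rule LIMSEQ_unique[symmetric])
  next
    fix v
    have "(\<lambda>n. Re (qform {..<d} (\<lambda>i j. A n $$ (i, j)) v)) \<longlonglongrightarrow> Re (qform {..<d} (\<lambda>i j. B $$ (i, j)) v)"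
      unfolding qform_def by (intro tendsto_intros mat_limD(3)[OF lim]) auto
    then show "0 \<le> Re (qform {..<d} (\<lambda>i j. B $$ (i, j)) v)"
      by (rule LIMSEQ_le_const) (use pos_kernelD(2)[OF pos] in blast)
  qed
  then show ?thesis using mat_limD(2)[OF lim] unfolding psd_iff_pos_kernel by blast
qed

lemma mat_lim_minus:
  assumes "mat_lim d A A'" "mat_lim d B B'"
  shows "mat_lim d (\<lambda>n. A n - B n) (A' - B')"
  unfolding mat_lim_def
proof (intro conjI allI impI)
  fix i j assume ij: "i < d" "j < d"
  have "(\<lambda>n. A n $$ (i, j) - B n $$ (i, j)) \<longlonglongrightarrow> A' $$ (i, j) - B' $$ (i, j)"
    using ij by (intro tendsto_diff mat_limD(3)[OF assms(1)] mat_limD(3)[OF assms(2)])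
  moreover have "dim_row (B n) = d" "dim_col (B n) = d" "dim_row B' = d" "dim_col B' = d" for n
    using mat_limD(1,2)[OF assms(2)] by auto
  ultimately show "(\<lambda>n. (A n - B n) $$ (i, j)) \<longlonglongrightarrow> (A' - B') $$ (i, j)"
    using ij by simp
qed (use mat_limD(1,2)[OF assms(1)] mat_limD(1,2)[OF assms(2)] in \<open>auto intro: minus_carrier_mat\<close>)

lemma mat_lim_ptranspose:
  assumes "mat_lim (a * b) A B"
  shows "mat_lim (a * b) (\<lambda>n. ptranspose_right a b (A n)) (ptranspose_right a b B)"
  unfolding mat_lim_def
proof (intro conjI allI impI)
  fix r c assume rc: "r < a * b" "c < a * b"
  then have "0 < b" by (cases b) auto
  then show "(\<lambda>n. ptranspose_right a b (A n) $$ (r, c)) \<longlonglongrightarrow> ptranspose_right a b B $$ (r, c)"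
    using rc by (simp add: ptranspose_right_def)
      (intro mat_limD(3)[OF assms] pair_index_less less_mult_imp_div_less mod_less_divisor)
qed (simp_all add: ptranspose_right_def)

lemma mat_lim_kron_one:
  assumes "mat_lim a A B"
  shows "mat_lim (a * b) (\<lambda>n. kron (A n) (1\<^sub>m b)) (kron B (1\<^sub>m b))"
  unfolding mat_lim_def
proof (intro conjI allI impI)
  fix r c assume rc: "r < a * b" "c < a * b"
  then have "(\<lambda>n. A n $$ (r div b, c div b) * 1\<^sub>m b $$ (r mod b, c mod b)) \<longlonglongrightarrow>
      B $$ (r div b, c div b) * 1\<^sub>m b $$ (r mod b, c mod b)"
    by (intro tendsto_intros mat_limD(3)[OF assms] less_mult_imp_div_less)
  moreover have "dim_row (A n) = a" "dim_col (A n) = a" "dim_row B = a" "dim_col B = a" for n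
    using mat_limD(1,2)[OF assms] by auto
  ultimately show "(\<lambda>n. kron (A n) (1\<^sub>m b) $$ (r, c)) \<longlonglongrightarrow> kron B (1\<^sub>m b) $$ (r, c)"
    using rc by (simp add: kron_def)
qed (intro kron_carrier mat_limD[OF assms] one_carrier_mat)+

lemma mat_lim_loewner:
  assumes "mat_lim d A A'" "mat_lim d B B'" "\<And>n. loewner_le d (A n) (B n)"
  shows "loewner_le d A' B'"
  unfolding loewner_le_def
  using mat_limD(2)[OF assms(1)] mat_limD(2)[OF assms(2)]
    mat_lim_psd[OF mat_lim_minus[OF assms(2,1)]] assms(3)
  by (auto simp: loewner_le_def)

lemma mat_lim_mtrace_mult:
  assumes "mat_lim d A B" "C \<in> carrier_mat d d"
  shows "(\<lambda>n. mtrace (C * A n)) \<longlonglongrightarrow> mtrace (C * B)"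
  unfolding mtrace_mult[OF assms(2) mat_limD(1)[OF assms(1)]] mtrace_mult[OF assms(2) mat_limD(2)[OF assms(1)]]
  by (intro tendsto_intros mat_limD(3)[OF assms(1)]) auto

lemma mat_lim_mtrace:
  assumes "mat_lim d A B"
  shows "(\<lambda>n. mtrace (A n)) \<longlonglongrightarrow> mtrace B"
  unfolding mtrace_carrier[OF mat_limD(1)[OF assms]] mtrace_carrier[OF mat_limD(2)[OF assms]]
  by (intro tendsto_intros mat_limD(3)[OF assms]) auto

lemma ptrace_left_eq_iff:
  "ptrace_left dA dB F = c \<cdot>\<^sub>m 1\<^sub>m dB \<longleftrightarrow>
    (\<forall>x<dB. \<forall>y<dB. (\<Sum>i<dA. F $$ (i * dB + x, i * dB + y)) = (if x = y then c else 0))"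
proof
  assume eq: "ptrace_left dA dB F = c \<cdot>\<^sub>m 1\<^sub>m dB"
  have "ptrace_left dA dB F $$ (x, y) = (if x = y then c else 0)" if "x < dB" "y < dB" for x y
    unfolding eq using that by simp
  then show "\<forall>x<dB. \<forall>y<dB. (\<Sum>i<dA. F $$ (i * dB + x, i * dB + y)) = (if x = y then c else 0)"
    by (simp add: ptrace_left_def)
qed (auto simp: ptrace_left_def intro!: eq_matI)

text \<open>Every constraint is closed. The error varies along the sequence while
  \<open>\<eta>\<close> is fixed, since the approximating codes share one number of
  messages.\<close>

lemma NS_feasible_limit:
  assumes F: "mat_lim (dA * dB) F F'" and \<rho>: "mat_lim dA \<rho> \<rho>'"
    and \<epsilon>: "\<epsilon> \<longlonglongrightarrow> \<epsilon>'" and feas: "\<And>n. NS_feasible dA dB N (\<epsilon> n) (F n) (\<rho> n) \<eta>"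
  shows "NS_feasible dA dB N \<epsilon>' F' \<rho>' \<eta>"
  unfolding NS_feasible_def
proof (intro conjI)
  note feas' = feas[unfolded NS_feasible_def]
  show "psd (dA * dB) F'" by (rule mat_lim_psd[OF F]) (use feas' in blast)
  show "loewner_le (dA * dB) F' (kron \<rho>' (1\<^sub>m dB))"
    by (rule mat_lim_loewner[OF F mat_lim_kron_one[OF \<rho>]]) (use feas' in blast)
  have "(\<lambda>n. mtrace (\<rho> n)) \<longlonglongrightarrow> 1" using feas' by simp
  then show "mtrace \<rho>' = 1" using LIMSEQ_unique[OF mat_lim_mtrace[OF \<rho>]] by blast
  show "ptrace_left dA dB F' = complex_of_real \<eta> \<cdot>\<^sub>m 1\<^sub>m dB"
    unfolding ptrace_left_eq_iff
  proof (intro allI impI)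
    fix x y assume xy: "x < dB" "y < dB"
    have "(\<lambda>n. \<Sum>i<dA. F n $$ (i * dB + x, i * dB + y)) \<longlonglongrightarrow> (\<Sum>i<dA. F' $$ (i * dB + x, i * dB + y))"
      using xy by (intro tendsto_intros mat_limD(3)[OF F] pair_index_less) auto
    moreover have "(\<Sum>i<dA. F n $$ (i * dB + x, i * dB + y)) = (if x = y then of_real \<eta> else 0)" for n
      using feas' xy unfolding ptrace_left_eq_iff by blast
    ultimately show "(\<Sum>i<dA. F' $$ (i * dB + x, i * dB + y)) = (if x = y then of_real \<eta> else 0)"
      by (simp add: LIMSEQ_const_iff)
  qed
  have "(\<lambda>n. 1 - \<epsilon> n) \<longlonglongrightarrow> 1 - \<epsilon>'" by (intro tendsto_intros \<epsilon>)
  moreover have "(\<lambda>n. Re (mtrace (choi dA dB N * F n))) \<longlonglongrightarrow> Re (mtrace (choi dA dB N * F'))"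
    by (intro tendsto_intros mat_lim_mtrace_mult[OF F choi_carrier])
  ultimately show "1 - \<epsilon>' \<le> Re (mtrace (choi dA dB N * F'))"
    by (rule LIMSEQ_le) (use feas' in blast)
qed (use mat_limD(2)[OF F] mat_limD(2)[OF \<rho>] in auto)

lemma PPT_feasible_limit:
  assumes F: "mat_lim (dA * dB) F F'" and \<rho>: "mat_lim dA \<rho> \<rho>'"
    and feas: "\<And>n. PPT_feasible dA dB (F n) (\<rho> n)"
  shows "PPT_feasible dA dB F' \<rho>'"
  unfolding PPT_feasible_def
  by (intro conjI mat_lim_psd[OF mat_lim_ptranspose[OF F]]
      mat_lim_loewner[OF mat_lim_ptranspose[OF F] mat_lim_kron_one[OF \<rho>]])
    (use feas[unfolded PPT_feasible_def] in blast)+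

section \<open>A priori bounds on feasible points and extraction of limits\<close>

lemma psd_entry_le_mtrace:
  assumes A: "psd d A" and ij: "i < d" "j < d"
  shows "cmod (A $$ (i, j)) \<le> Re (mtrace A)"
proof -
  have pos: "pos_kernel {..<d} (\<lambda>i j. A $$ (i, j))"
    using A unfolding psd_iff_pos_kernel by (rule conjunct2)
  have "Re (A $$ (k, k)) \<le> Re (mtrace A)" if "k < d" for k
  proof -
    have "Re (A $$ (k, k)) \<le> (\<Sum>i<d. Re (A $$ (i, i)))"
      by (rule member_le_sum) (use that pos_kernel_diag(1)[OF pos] in auto)
    then show ?thesis by (simp add: mtrace_carrier[OF psd_carrier[OF A]])
  qed
  \<comment> \<open>Twice the modulus of the entry is at most the sum of two diagonal entries, each
    bounded by the trace.\<close>
  from this[OF ij(1)] this[OF ij(2)] pos_kernel_entry_le_diag[OF pos, of i j] ij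
  show ?thesis by simp
qed

lemma NS_feasible_mtrace:
  assumes "NS_feasible dA dB N \<epsilon> F \<rho> \<eta>"
  shows "mtrace F = of_real (real dB * \<eta>)"
proof -
  have F: "F \<in> carrier_mat (dA * dB) (dA * dB)"
    and pt: "ptrace_left dA dB F = complex_of_real \<eta> \<cdot>\<^sub>m 1\<^sub>m dB"
    using assms by (auto simp: NS_feasible_def)
  have "mtrace F = (\<Sum>x<dB. \<Sum>i<dA. F $$ (i * dB + x, i * dB + x))"
    unfolding mtrace_carrier[OF F] sum_pair_index by (rule sum.swap)
  also have "\<dots> = (\<Sum>x<dB. of_real \<eta>)"
    using pt unfolding ptrace_left_eq_iff by simp
  finally show ?thesis by simp
qed

text \<open>The constraints control \<open>\<rho>\<close> through its tensor product with the
  identity, which is the sum of the two positive matrices \<open>?K - F\<close> and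
  \<open>F\<close>, of total trace \<open>dB\<close>.\<close>

lemma NS_feasible_\<rho>_bound:
  assumes feas: "NS_feasible dA dB N \<epsilon> F \<rho> \<eta>" and dB: "0 < dB" and ij: "i < dA" "j < dA"
  shows "cmod (\<rho> $$ (i, j)) \<le> real dB"
proof -
  let ?K = "kron \<rho> (1\<^sub>m dB)"
  have \<rho>: "\<rho> \<in> carrier_mat dA dA" "mtrace \<rho> = 1" and F: "psd (dA * dB) F" "psd (dA * dB) (?K - F)"
    using feas by (auto simp: NS_feasible_def loewner_le_def)
  note c = psd_carrier[OF F(1)]
  have idx: "i * dB + 0 < dA * dB" "j * dB + 0 < dA * dB" using pair_index_less ij dB by blast+
  \<comment> \<open>The entry is read off at \<open>B\<close> index \<open>0\<close>, which exists
    because \<open>dB\<close> is positive.\<close>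
  have "\<rho> $$ (i, j) = ?K $$ (i * dB + 0, j * dB + 0)"
    using ij dB by (subst kron_index[OF \<rho>(1) one_carrier_mat]) simp_all
  also have "\<dots> = (?K - F) $$ (i * dB + 0, j * dB + 0) + F $$ (i * dB + 0, j * dB + 0)"
    using c idx by simp
  also have "cmod \<dots> \<le> Re (mtrace (?K - F)) + Re (mtrace F)"
    by (rule norm_triangle_mono[OF psd_entry_le_mtrace[OF F(2) idx] psd_entry_le_mtrace[OF F(1) idx]])
  also have "\<dots> = Re (mtrace ?K)"
    using c by (simp add: mtrace_carrier[OF psd_carrier[OF F(2)]] mtrace_carrier[OF c]
        mtrace_carrier[OF kron_carrier[OF \<rho>(1) one_carrier_mat]] sum_subtractf)
  also have "mtrace ?K = (\<Sum>i<dA. \<Sum>x<dB. \<rho> $$ (i, i))"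
    unfolding mtrace_carrier[OF kron_carrier[OF \<rho>(1) one_carrier_mat]] sum_pair_index
    by (intro sum.cong refl) (simp add: kron_index[OF \<rho>(1) one_carrier_mat])
  also have "\<dots> = of_nat dB * mtrace \<rho>"
    by (simp add: mtrace_carrier[OF \<rho>(1)] sum_distrib_left)
  finally show ?thesis using \<rho>(2) by simp
qed

text \<open>The entries of \<open>F\<close> and \<open>\<rho>\<close> form one family over a
  disjoint sum, so that both converge along the same subsequence.\<close>

lemma NS_feasible_compact:
  fixes F \<rho> :: "nat \<Rightarrow> complex mat"
  assumes feas: "\<And>n. NS_feasible dA dB N (\<epsilon> n) (F n) (\<rho> n) \<eta>" and dB: "0 < dB"
  obtains r F' \<rho>' where "strict_mono r"
    "mat_lim (dA * dB) (\<lambda>n. F (r n)) F'" "mat_lim dA (\<lambda>n. \<rho> (r n)) \<rho>'"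
proof -
  define f where "f n z = (case z of Inl ij \<Rightarrow> F n $$ ij | Inr ij \<Rightarrow> \<rho> n $$ ij)" for n z
  define S where "S = ({..<dA * dB} \<times> {..<dA * dB}) <+> ({..<dA} \<times> {..<dA})"
  have "cmod (F n $$ (i, j)) \<le> real dB * \<eta>" if "i < dA * dB" "j < dA * dB" for n i j
    using psd_entry_le_mtrace[OF _ that, of "F n"] NS_feasible_mtrace[OF feas] feas[of n]
    by (simp add: NS_feasible_def)
  then have "cmod (f n z) \<le> max (real dB * \<eta>) (real dB)" if "z \<in> S" for n z
    using that NS_feasible_\<rho>_bound[OF feas dB] by (auto simp: S_def f_def le_max_iff_disj)
  moreover have "finite S" by (simp add: S_def)
  ultimately obtain r l where r: "strict_mono r"
    and l: "\<And>z. z \<in> S \<Longrightarrow> (\<lambda>n. f (r n) z) \<longlonglongrightarrow> l z"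
    using bounded_complex_families_convergent_subseq[of S f] by blast
  have "F n \<in> carrier_mat (dA * dB) (dA * dB)" "\<rho> n \<in> carrier_mat dA dA" for n
    using feas[of n] by (auto simp: NS_feasible_def)
  moreover have "(\<lambda>n. F (r n) $$ (i, j)) \<longlonglongrightarrow> l (Inl (i, j))" if "i < dA * dB" "j < dA * dB" for i j
    using l[of "Inl (i, j)"] that by (auto simp: S_def f_def)
  moreover have "(\<lambda>n. \<rho> (r n) $$ (i, j)) \<longlonglongrightarrow> l (Inr (i, j))" if "i < dA" "j < dA" for i j
    using l[of "Inr (i, j)"] that by (auto simp: S_def f_def)
  ultimately have "mat_lim (dA * dB) (\<lambda>n. F (r n)) (mat (dA * dB) (dA * dB) (\<lambda>ij. l (Inl ij)))"
    "mat_lim dA (\<lambda>n. \<rho> (r n)) (mat dA dA (\<lambda>ij. l (Inr ij)))"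
    by (simp_all add: mat_lim_def)
  with r that show thesis by blast
qed

text \<open>The suprema defining the success probabilities need not be attained, so codes only give
  points feasible for every larger error.\<close>

lemma NS_feasible_closed:
  assumes feas: "\<And>\<delta>. 0 < \<delta> \<Longrightarrow> \<exists>F \<rho>. NS_feasible dA dB N (\<epsilon> + \<delta>) F \<rho> \<eta> \<and> (ppt \<longrightarrow> PPT_feasible dA dB F \<rho>)"
    and dB: "0 < dB"
  shows "\<exists>F \<rho>. NS_feasible dA dB N \<epsilon> F \<rho> \<eta> \<and> (ppt \<longrightarrow> PPT_feasible dA dB F \<rho>)"
proof -
  have "\<forall>n. \<exists>F \<rho>. NS_feasible dA dB N (\<epsilon> + inverse (real (Suc n))) F \<rho> \<eta> \<and>
      (ppt \<longrightarrow> PPT_feasible dA dB F \<rho>)"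
    using feas by simp
  then obtain F \<rho> where F: "\<And>n. NS_feasible dA dB N (\<epsilon> + inverse (real (Suc n))) (F n) (\<rho> n) \<eta>"
    and P: "\<And>n. ppt \<Longrightarrow> PPT_feasible dA dB (F n) (\<rho> n)" by metis
  obtain r F' \<rho>' where r: "strict_mono r"
    and lim: "mat_lim (dA * dB) (\<lambda>n. F (r n)) F'" "mat_lim dA (\<lambda>n. \<rho> (r n)) \<rho>'"
    by (rule NS_feasible_compact[OF F dB])
  have "(\<lambda>n. \<epsilon> + inverse (real (Suc n))) \<longlonglongrightarrow> \<epsilon> + 0"
    by (intro tendsto_intros LIMSEQ_inverse_real_of_nat)
  from LIMSEQ_subseq_LIMSEQ[OF this r]
  have "(\<lambda>n. \<epsilon> + inverse (real (Suc (r n)))) \<longlonglongrightarrow> \<epsilon>" by (simp add: o_def)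
  then have "NS_feasible dA dB N \<epsilon> F' \<rho>' \<eta>"
    by (rule NS_feasible_limit[OF lim]) (rule F)
  moreover have "PPT_feasible dA dB F' \<rho>'" if ppt
    by (rule PPT_feasible_limit[OF lim]) (rule P[OF that])
  ultimately show ?thesis by blast
qed

text \<open>Without a positive bound the infimum could be \<open>0\<close>, where \<open>log 2 0 = 0\<close> is a junk value.\<close>

lemma NS_feasible_lower_bound:
  assumes "\<epsilon> < 1"
  obtains c where "0 < c" "\<And>F \<rho> \<eta>. NS_feasible dA dB N \<epsilon> F \<rho> \<eta> \<Longrightarrow> c \<le> \<eta>"
proof -
  \<comment> \<open>The entrywise 1-norm of the Choi matrix: the entries of \<open>F\<close> are
    bounded by its trace, so the success value is at most \<open>J\<close> times that trace.\<close>
  define J where "J = (\<Sum>r<dA * dB. \<Sum>s<dA * dB. cmod (choi dA dB N $$ (r, s)))"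
  have J: "0 \<le> J" unfolding J_def by (intro sum_nonneg) simp
  have bound: "1 - \<epsilon> \<le> J * (real dB * \<eta>)" if feas: "NS_feasible dA dB N \<epsilon> F \<rho> \<eta>" for F \<rho> \<eta>
  proof -
    have F: "psd (dA * dB) F" using feas by (simp add: NS_feasible_def)
    have "1 - \<epsilon> \<le> Re (mtrace (choi dA dB N * F))" using feas by (simp add: NS_feasible_def)
    also have "\<dots> \<le> cmod (mtrace (choi dA dB N * F))" by (rule complex_Re_le_cmod)
    also have "\<dots> \<le> (\<Sum>r<dA * dB. \<Sum>s<dA * dB. cmod (choi dA dB N $$ (r, s)) * Re (mtrace F))"
      unfolding mtrace_mult[OF choi_carrier psd_carrier[OF F]]
      by (intro sum_norm_le) (auto simp: norm_mult intro!: mult_left_mono psd_entry_le_mtrace[OF F])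
    also have "\<dots> = J * (real dB * \<eta>)"
      by (simp add: NS_feasible_mtrace[OF feas] J_def sum_distrib_right)
    finally show ?thesis .
  qed
  show thesis
  \<comment> \<open>In the degenerate case the bound would read
    \<open>1 - \<epsilon> \<le> 0\<close>; nothing is feasible and any positive constant
    serves.\<close>
  proof (cases "J * real dB = 0")
    case True
    have "\<not> NS_feasible dA dB N \<epsilon> F \<rho> \<eta>" for F \<rho> \<eta>
      using bound[of F \<rho> \<eta>] True assms by auto
    then show thesis using that[of 1] by simp
  next
    case False
    then have pos: "0 < J * real dB" using J by simp
    show thesis
    proof (rule that[of "(1 - \<epsilon>) / (J * real dB)"])
      show "0 < (1 - \<epsilon>) / (J * real dB)" using pos assms by simp
      show "(1 - \<epsilon>) / (J * real dB) \<le> \<eta>" if "NS_feasible dA dB N \<epsilon> F \<rho> \<eta>" for F \<rho> \<eta>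
        using bound[OF that] pos by (simp add: pos_divide_le_eq mult_ac)
    qed
  qed
qed

section \<open>From feasible points to the capacity bounds\<close>

lemma log_le_neg_log_Inf:
  fixes S :: "real set"
  assumes c: "0 < c" "\<And>\<eta>. \<eta> \<in> S \<Longrightarrow> c \<le> \<eta>" and m: "0 < m" "1 / real m \<in> S"
  shows "log 2 (real m) \<le> - log 2 (Inf S)"
proof -
  \<comment> \<open>This keeps the infimum in the positive range, where \<open>log 2\<close> is
    monotone.\<close>
  have "c \<le> Inf S" using m(2) by (intro cInf_greatest c) auto
  moreover have "Inf S \<le> 1 / real m"
    using m(2) c(2) by (intro cInf_lower bdd_belowI) auto
  ultimately have "log 2 (Inf S) \<le> log 2 (1 / real m)" using c(1) m(1) by simp
  then show ?thesis using m(1) by (simp add: log_divide)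
qed

lemma NS_feasible_of_f_EA:
  assumes d: "1 \<le> dA" "1 \<le> dB" and N: "quantum_channel dA dB N"
    and m: "1 \<le> m" "1 - f_EA dA dB N m \<le> \<epsilon>"
  shows "\<exists>F \<rho>. NS_feasible dA dB N \<epsilon> F \<rho> (1 / real m)"
proof -
  \<comment> \<open>The flag \<open>False\<close> selects the program without PPT conditions in
    \<open>NS_feasible_closed\<close>.\<close>
  have "\<exists>F \<rho>. NS_feasible dA dB N (\<epsilon> + \<delta>) F \<rho> (1 / real m) \<and> (False \<longrightarrow> PPT_feasible dA dB F \<rho>)"
    if \<delta>: "0 < \<delta>" for \<delta>
  proof -
    let ?S = "{success_prob m (EA_code_map dA dB N m a b \<phi> E D) | a b \<phi> E D.
      density (a * b) \<phi> \<and> quantum_channel (m * a) dA E \<and> quantum_channel (dB * b) m D}"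
    \<comment> \<open>One-dimensional assistance together with replacement channels gives a code, so
      the supremum is over a nonempty set.\<close>
    have "density (1 * 1) (ketbra 1 0 0)"
      using psd_ketbra[of 1 0] by (simp add: density_def mtrace_def ketbra_index)
    then have ne: "?S \<noteq> {}"
      using quantum_channel_replace[of dA "m * 1"] quantum_channel_replace[of m "dB * 1"] d m(1)
      by fastforce
    \<comment> \<open>The slack \<open>\<delta>\<close> makes the inequality strict, so some code
      exceeds the left-hand side even if no code attains the supremum.\<close>
    have lt: "1 - \<epsilon> - \<delta> < Sup ?S" using m(2) \<delta> by (simp add: f_EA_def)
    obtain x where "x \<in> ?S" "1 - \<epsilon> - \<delta> < x" by (rule less_cSupE[OF lt ne])
    then obtain a b \<phi> E D where "density (a * b) \<phi>" "quantum_channel (m * a) dA E"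
      "quantum_channel (dB * b) m D" "1 - \<epsilon> - \<delta> < success_prob m (EA_code_map dA dB N m a b \<phi> E D)"
      by blast
    then show ?thesis using EA_code_feasible[OF N, of m a b \<phi> E D "\<epsilon> + \<delta>"] m(1) by simp
  qed
  from NS_feasible_closed[OF this] d(2) show ?thesis by auto
qed

lemma NS_PPT_feasible_of_f_UA:
  assumes d: "1 \<le> dA" "1 \<le> dB" and N: "quantum_channel dA dB N"
    and m: "1 \<le> m" "1 - f_UA dA dB N m \<le> \<epsilon>"
  shows "\<exists>F \<rho>. NS_feasible dA dB N \<epsilon> F \<rho> (1 / real m) \<and> PPT_feasible dA dB F \<rho>"
proof -
  have "\<exists>F \<rho>. NS_feasible dA dB N (\<epsilon> + \<delta>) F \<rho> (1 / real m) \<and> (True \<longrightarrow> PPT_feasible dA dB F \<rho>)"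
    if \<delta>: "0 < \<delta>" for \<delta>
  proof -
    let ?S = "{success_prob m (D \<circ> N \<circ> E) | E D. quantum_channel m dA E \<and> quantum_channel dB m D}"
    have ne: "?S \<noteq> {}"
      using quantum_channel_replace[of dA m] quantum_channel_replace[of m dB] d m(1) by fastforce
    have lt: "1 - \<epsilon> - \<delta> < Sup ?S" using m(2) \<delta> by (simp add: f_UA_def)
    obtain x where "x \<in> ?S" "1 - \<epsilon> - \<delta> < x" by (rule less_cSupE[OF lt ne])
    then obtain E D where "quantum_channel m dA E" "quantum_channel dB m D"
      "1 - \<epsilon> - \<delta> < success_prob m (D \<circ> N \<circ> E)"
      by blast
    then show ?thesis using UA_code_feasible[OF N, of m E D "\<epsilon> + \<delta>"] m(1) by simp
  qed
  from NS_feasible_closed[OF this] d(2) show ?thesis by auto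
qed

theorem corollary5:
  fixes N :: "complex mat \<Rightarrow> complex mat" and dA dB :: nat and \<epsilon> :: real
  assumes "1 \<le> dA" "1 \<le> dB"
    and "quantum_channel dA dB N"
    and "0 \<le> \<epsilon>" "\<epsilon> < 1"
  shows "capacity_E dA dB N \<epsilon> \<le> ereal (capacity_NS dA dB N \<epsilon>) \<and>
         capacity dA dB N \<epsilon> \<le> ereal (capacity_NS_PPT dA dB N \<epsilon>)"
proof -
  \<comment> \<open>One constant serves both programs, since every point of the PPT program is also
    feasible for the NS program.\<close>
  obtain c where c: "0 < c" "\<And>F \<rho> \<eta>. NS_feasible dA dB N \<epsilon> F \<rho> \<eta> \<Longrightarrow> c \<le> \<eta>"
    using NS_feasible_lower_bound[OF assms(5)] by blast
  have "log 2 (real m) \<le> capacity_NS dA dB N \<epsilon>" if "1 \<le> m" "1 - f_EA dA dB N m \<le> \<epsilon>" for m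
    unfolding capacity_NS_def
    by (rule log_le_neg_log_Inf[OF c(1)]) (use c(2) that NS_feasible_of_f_EA[OF assms(1-3) that] in auto)
  moreover have "log 2 (real m) \<le> capacity_NS_PPT dA dB N \<epsilon>"
    if "1 \<le> m" "1 - f_UA dA dB N m \<le> \<epsilon>" for m
    unfolding capacity_NS_PPT_def
    by (rule log_le_neg_log_Inf[OF c(1)]) (use c(2) that NS_PPT_feasible_of_f_UA[OF assms(1-3) that] in auto)
  ultimately show ?thesis
    unfolding capacity_E_def capacity_def by (intro conjI Sup_least) auto
qed

end
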